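(* Let $\alpha,\beta,\gamma,\delta,k$ be constants with $\gamma+\delta\neq0$, $(\alpha\gamma,\beta\delta)\neq(0,0)$ and $k\neq0$. Consider, for all $n\in\mathbb{Z}$, the following equations. (i) First flow: $$\mathrm{i}q_{n,t_1}-\alpha u_n^{\gamma}q_{n-1}-\beta u_{n+1}^{\delta}q_{n+1}-w_nq_n=0,\qquad \mathrm{i}r_{n,t_1}+\beta u_n^{\delta}r_{n-1}+\alpha u_{n+1}^{\gamma}r_{n+1}+w_nr_n=0,$$ $$u_{n,y}=u_n\left(q_{n-1}r_{n-1}-q_nr_n\right),$$ $$w_{n,y}=\alpha\delta\left(u_n^{\gamma}q_{n-1}r_n-u_{n+1}^{\gamma}q_nr_{n+1}\right)+\beta\gamma\left(u_n^{\delta}q_nr_{n-1}-u_{n+1}^{\delta}q_{n+1}r_n\right).$$ (ii) Second flow: $$kq_{n,t_2}+q_{n,yy}+q_n\left(\gamma v_n+\delta v_{n+1}\right)+\gamma\delta\left(q_nr_n\right)^2q_n=0,$$ $$kr_{n,t_2}-r_{n,yy}-\left(\delta v_n+\gamma v_{n+1}\right)r_n-\gamma\delta\, r_n\left(q_nr_n\right)^2=0,\qquad v_{n+1}-v_n=-2\left(r_nq_n\right)_y.$$ (iii) Evolution of the auxiliary variables: $$\mathrm{i}v_{n,t_1}=2\left(\alpha u_n^{\gamma}r_nq_{n-1}-\beta u_n^{\delta}r_{n-1}q_n\right)_y+\mathcal{F},$$ $$k\left(\log u_n\right)_{t_2}=\left[q_{n,y}r_n-q_nr_{n,y}+(\gamma-\delta)\left(q_nr_n\right)^2\right]-\left[q_{n-1,y}r_{n-1}-q_{n-1}r_{n-1,y}+(\gamma-\delta)\left(q_{n-1}r_{n-1}\right)^2\right],$$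 $$\begin{aligned}kw_{n,t_2}={}&\beta\gamma u_n^{\delta}\left[-q_{n,y}r_{n-1}+q_nr_{n-1,y}+\delta\left(q_{n-1}r_{n-1}+q_nr_n\right)q_nr_{n-1}\right]\\&-\beta\gamma u_{n+1}^{\delta}\left[-q_{n+1,y}r_n+q_{n+1}r_{n,y}+\delta\left(q_nr_n+q_{n+1}r_{n+1}\right)q_{n+1}r_n\right]\\&+\alpha\delta u_n^{\gamma}\left[-q_{n-1,y}r_n+q_{n-1}r_{n,y}-\gamma\left(q_{n-1}r_{n-1}+q_nr_n\right)q_{n-1}r_n\right]\\&-\alpha\delta u_{n+1}^{\gamma}\left[-q_{n,y}r_{n+1}+q_nr_{n+1,y}-\gamma\left(q_nr_n+q_{n+1}r_{n+1}\right)q_nr_{n+1}\right]+\mathcal{H}_n,\end{aligned}$$ where the "constants" of integration are $\mathcal{F}$, an $n$-independent $M\times M$ matrix, and $\mathcal{H}_n$, a $y$-independent scalar. These equations imply that the two differentiation operators $\partial_{t_1}$ and $\partial_{t_2}$ commute, i.e., $$q_{n,t_1t_2}=q_{n,t_2t_1}\quad\text{and}\quad r_{n,t_1t_2}=r_{n,t_2t_1},$$ if and only if $\mathcal{F}$ and $\mathcal{H}_n$ satisfy the condition $$(\gamma+\delta)\mathcal{F}+\mathcal{H}_nI_M=0,$$ where $I_M$ is the $M\times M$ identity matrix. Therefore, $\mathcal{F}$ should be $y$-independent and $\mathcal{H}_n$ should be $n$-independent, namely, $\mathcal{F}_y=0$ and $\mathcal{H}_n=\mathcal{H}$; by the change of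 dependent variables $$q_n=\widetilde{q}_n\exp\left(-\frac{\mathrm{i}}{k}\iint\mathcal{H}\,\mathrm{d}t_1\mathrm{d}t_2\right),\qquad r_n=\widetilde{r}_n\exp\left(\frac{\mathrm{i}}{k}\iint\mathcal{H}\,\mathrm{d}t_1\mathrm{d}t_2\right),$$ we can set $\mathcal{F}=0$ and $\mathcal{H}=0$ without loss of generality.
   Context: Here $n\in\mathbb{Z}$ is a discrete spatial variable, $y$ is a continuous spatial variable, $t_1,t_2$ are continuous time variables, and the subscripts $y,t_1,t_2$ denote partial differentiation; $q_{n,t_1t_2}$ is obtained by differentiating $q_{n,t_1}$ with respect to $t_2$, and similarly for the other second derivatives. For a fixed positive integer $M$, $q_n$ is an $M$-component row vector, $r_n$ an $M$-component column vector, $u_n,w_n$ are scalar functions (with $u_n$ nonzero so that its powers and logarithm make sense) and $v_n$ is an $M\times M$ matrix; thus $q_mr_n$ is a scalar and $r_mq_n$ an $M\times M$ matrix. The symbol $\iint\mathcal{H}\,\mathrm{d}t_1\mathrm{d}t_2$ denotes a double antiderivative of $\mathcal{H}$ in $t_1$ and $t_2$. *)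

theory Defs
  imports "HOL-Analysis.Analysis"
begin

text \<open>Functions all of whose iterated directional derivatives exist and are continuous.\<close>

fun k_times_diff :: "nat \<Rightarrow> ('a::real_normed_vector \<Rightarrow> 'b::real_normed_vector) \<Rightarrow> bool" where
  "k_times_diff 0 f \<longleftrightarrow> continuous_on UNIV f"
| "k_times_diff (Suc m) f \<longleftrightarrow>
     (\<forall>x. f differentiable (at x)) \<and> (\<forall>h. k_times_diff m (\<lambda>x. frechet_derivative f (at x) h))"

definition smooth :: "('a::real_normed_vector \<Rightarrow> 'b::real_normed_vector) \<Rightarrow> bool" where
  "smooth f \<longleftrightarrow> (\<forall>m. k_times_diff m f)"

abbreviation pd :: "(real \<Rightarrow> 'b::real_normed_vector) \<Rightarrow> real \<Rightarrow> 'b" where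
  "pd f x \<equiv> vector_derivative f (at x)"

text \<open>Row and column vectors both have type \<open>complex^'m\<close>: for a row vector \<open>a\<close> and a column
  vector \<open>b\<close>, \<open>row_col a b\<close> is the scalar \<open>a b\<close> (bilinear, without conjugation),
  \<open>col_row b a\<close> is the matrix \<open>b a\<close>, and \<open>a v* A\<close>, \<open>A *v b\<close> are the products with a matrix.\<close>

definition row_col :: "complex^'m \<Rightarrow> complex^'m \<Rightarrow> complex" where
  "row_col a b = (\<Sum>j\<in>UNIV. a $ j * b $ j)"

definition col_row :: "complex^'m \<Rightarrow> complex^'m \<Rightarrow> complex^'m^'m" where
  "col_row b a = (\<chi> i j. b $ i * a $ j)"

definition smat :: "complex \<Rightarrow> complex^'m^'m \<Rightarrow> complex^'m^'m" where
  "smat c A = (\<chi> i j. c * A $ i $ j)"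

text \<open>The dependent variables at a fixed time \<open>(t\<^sub>1, t\<^sub>2)\<close>, as functions of \<open>n\<close> and \<open>y\<close>.
  A nonvanishing \<open>u\<^sub>n\<close> is given together with a branch \<open>logu\<close> of its logarithm, so that
  \<open>u\<^sub>n\<close> and \<open>u\<^sub>n\<^sup>c\<close> for a complex exponent \<open>c\<close> depend smoothly on the data.\<close>

record 'm fields =
  q :: "int \<Rightarrow> real \<Rightarrow> complex^'m"
  r :: "int \<Rightarrow> real \<Rightarrow> complex^'m"
  logu :: "int \<Rightarrow> real \<Rightarrow> complex"
  v :: "int \<Rightarrow> real \<Rightarrow> complex^'m^'m"
  w :: "int \<Rightarrow> real \<Rightarrow> complex"

definition u :: "'m::finite fields \<Rightarrow> int \<Rightarrow> real \<Rightarrow> complex" where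
  "u s n y = exp (logu s n y)"

definition upow :: "'m::finite fields \<Rightarrow> complex \<Rightarrow> int \<Rightarrow> real \<Rightarrow> complex" where
  "upow s c n y = exp (c * logu s n y)"

abbreviation qr :: "'m::finite fields \<Rightarrow> int \<Rightarrow> int \<Rightarrow> real \<Rightarrow> complex" where
  "qr s l n y \<equiv> row_col (q s l y) (r s n y)"

definition smooth_fields :: "'m::finite fields \<Rightarrow> bool" where
  "smooth_fields s \<longleftrightarrow> (\<forall>n. smooth (q s n) \<and> smooth (r s n) \<and> smooth (logu s n)
     \<and> smooth (v s n) \<and> smooth (w s n))"

text \<open>The relations of the system that contain no time derivative.\<close>

definition constraints ::
  "complex \<Rightarrow> complex \<Rightarrow> complex \<Rightarrow> complex \<Rightarrow> 'm::finite fields \<Rightarrow> bool" where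
  "constraints \<alpha> \<beta> \<gamma> \<delta> s \<longleftrightarrow> (\<forall>n y.
     pd (u s n) y = u s n y * (qr s (n-1) (n-1) y - qr s n n y) \<and>
     pd (w s n) y =
       \<alpha> * \<delta> * (upow s \<gamma> n y * qr s (n-1) n y - upow s \<gamma> (n+1) y * qr s n (n+1) y)
       + \<beta> * \<gamma> * (upow s \<delta> n y * qr s n (n-1) y - upow s \<delta> (n+1) y * qr s (n+1) n y) \<and>
     v s (n+1) y - v s n y = smat (-2) (pd (\<lambda>z. col_row (r s n z) (q s n z)) y))"

text \<open>In the next two definitions \<open>s'\<close> holds the \<open>t\<^sub>1\<close>- resp. \<open>t\<^sub>2\<close>-derivatives of the
  fields \<open>s\<close>; in particular \<open>logu s'\<close> is the derivative of \<open>log u\<close>. The system does not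
  prescribe the \<open>t\<^sub>1\<close>-derivatives of \<open>u\<close>, \<open>w\<close> nor the \<open>t\<^sub>2\<close>-derivative of \<open>v\<close>.\<close>

definition t1_flow ::
  "complex \<Rightarrow> complex \<Rightarrow> complex \<Rightarrow> complex \<Rightarrow> (real \<Rightarrow> complex^'m::finite^'m)
    \<Rightarrow> 'm::finite fields \<Rightarrow> 'm fields \<Rightarrow> bool" where
  "t1_flow \<alpha> \<beta> \<gamma> \<delta> F s s' \<longleftrightarrow> (\<forall>n y.
     \<i> *s q s' n y - (\<alpha> * upow s \<gamma> n y) *s q s (n-1) y
       - (\<beta> * upow s \<delta> (n+1) y) *s q s (n+1) y - w s n y *s q s n y = 0 \<and>
     \<i> *s r s' n y + (\<beta> * upow s \<delta> n y) *s r s (n-1) y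
       + (\<alpha> * upow s \<gamma> (n+1) y) *s r s (n+1) y + w s n y *s r s n y = 0 \<and>
     smat \<i> (v s' n y) =
       smat 2 (pd (\<lambda>z. smat (\<alpha> * upow s \<gamma> n z) (col_row (r s n z) (q s (n-1) z))
                     - smat (\<beta> * upow s \<delta> n z) (col_row (r s (n-1) z) (q s n z))) y)
       + F y)"

definition t2_flow ::
  "complex \<Rightarrow> complex \<Rightarrow> complex \<Rightarrow> complex \<Rightarrow> complex \<Rightarrow> (int \<Rightarrow> complex)
    \<Rightarrow> 'm::finite fields \<Rightarrow> 'm fields \<Rightarrow> bool" where
  "t2_flow \<alpha> \<beta> \<gamma> \<delta> k H s s' \<longleftrightarrow> (\<forall>n y.
     k *s q s' n y + pd (pd (q s n)) y + q s n y v* (smat \<gamma> (v s n y) + smat \<delta> (v s (n+1) y))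
       + (\<gamma> * \<delta> * (qr s n n y)\<^sup>2) *s q s n y = 0 \<and>
     k *s r s' n y - pd (pd (r s n)) y - (smat \<delta> (v s n y) + smat \<gamma> (v s (n+1) y)) *v r s n y
       - (\<gamma> * \<delta> * (qr s n n y)\<^sup>2) *s r s n y = 0 \<and>
     k * logu s' n y =
       (row_col (pd (q s n) y) (r s n y) - row_col (q s n y) (pd (r s n) y)
          + (\<gamma> - \<delta>) * (qr s n n y)\<^sup>2)
       - (row_col (pd (q s (n-1)) y) (r s (n-1) y) - row_col (q s (n-1) y) (pd (r s (n-1)) y)
          + (\<gamma> - \<delta>) * (qr s (n-1) (n-1) y)\<^sup>2) \<and>
     k * w s' n y =
       \<beta> * \<gamma> * upow s \<delta> n y *
         (- row_col (pd (q s n) y) (r s (n-1) y) + row_col (q s n y) (pd (r s (n-1)) y)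
          + \<delta> * (qr s (n-1) (n-1) y + qr s n n y) * qr s n (n-1) y)
       - \<beta> * \<gamma> * upow s \<delta> (n+1) y *
         (- row_col (pd (q s (n+1)) y) (r s n y) + row_col (q s (n+1) y) (pd (r s n) y)
          + \<delta> * (qr s n n y + qr s (n+1) (n+1) y) * qr s (n+1) n y)
       + \<alpha> * \<delta> * upow s \<gamma> n y *
         (- row_col (pd (q s (n-1)) y) (r s n y) + row_col (q s (n-1) y) (pd (r s n) y)
          - \<gamma> * (qr s (n-1) (n-1) y + qr s n n y) * qr s (n-1) n y)
       - \<alpha> * \<delta> * upow s \<gamma> (n+1) y *
         (- row_col (pd (q s n) y) (r s (n+1) y) + row_col (q s n y) (pd (r s (n+1)) y)
          - \<gamma> * (qr s n n y + qr s (n+1) (n+1) y) * qr s n (n+1) y)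
       + H n)"

text \<open>A system of evolution equations assigns to the fields \<open>s\<close> their time derivative \<open>X s\<close>.
  The operator \<open>\<partial>\<^sub>t\<close> then acts on any quantity \<open>G\<close> built from the fields by the chain rule,
  i.e. as the derivative of \<open>G\<close> along \<open>X\<close>. Applied to the coordinate \<open>q\<^sub>n\<close>
  it returns \<open>q\<^sub>n\<^sub>,\<^sub>t\<close> as a function of the fields, which can be differentiated again.\<close>

definition displace :: "'m::finite fields \<Rightarrow> real \<Rightarrow> 'm fields \<Rightarrow> 'm fields" where
  "displace s \<epsilon> s' =
     \<lparr> q = \<lambda>n y. q s n y + \<epsilon> *\<^sub>R q s' n y,
       r = \<lambda>n y. r s n y + \<epsilon> *\<^sub>R r s' n y,
       logu = \<lambda>n y. logu s n y + \<epsilon> *\<^sub>R logu s' n y,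
       v = \<lambda>n y. v s n y + \<epsilon> *\<^sub>R v s' n y,
       w = \<lambda>n y. w s n y + \<epsilon> *\<^sub>R w s' n y \<rparr>"

definition time_deriv ::
  "('m::finite fields \<Rightarrow> 'm fields) \<Rightarrow> ('m fields \<Rightarrow> 'b::real_normed_vector) \<Rightarrow> 'm fields \<Rightarrow> 'b" where
  "time_deriv X G s = vector_derivative (\<lambda>\<epsilon>. G (displace s \<epsilon> (X s))) (at 0)"

text \<open>\<open>X\<^sub>1\<close>, \<open>X\<^sub>2\<close> range over all vector fields compatible with the equations, which are solved
  for the time derivatives; the constraints are imposed on the fields at which the second
  derivatives \<open>q\<^sub>n\<^sub>,\<^sub>t\<^sub>1\<^sub>t\<^sub>2\<close>, \<open>q\<^sub>n\<^sub>,\<^sub>t\<^sub>2\<^sub>t\<^sub>1\<close> are compared. For genuine solutions depending smoothly on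
  both times these agree automatically; here they are the expressions resulting from the
  equations, for arbitrary field values at the given time.\<close>

definition time_derivs_commute ::
  "complex \<Rightarrow> complex \<Rightarrow> complex \<Rightarrow> complex \<Rightarrow> complex \<Rightarrow> (real \<Rightarrow> complex^'m::finite^'m)
    \<Rightarrow> (int \<Rightarrow> complex) \<Rightarrow> bool" where
  "time_derivs_commute \<alpha> \<beta> \<gamma> \<delta> k F H \<longleftrightarrow>
     (\<forall>X\<^sub>1 X\<^sub>2 :: 'm fields \<Rightarrow> 'm fields.
       (\<forall>s. smooth_fields s \<longrightarrow> smooth_fields (X\<^sub>1 s) \<and> t1_flow \<alpha> \<beta> \<gamma> \<delta> F s (X\<^sub>1 s)) \<longrightarrow>
       (\<forall>s. smooth_fields s \<longrightarrow> smooth_fields (X\<^sub>2 s) \<and> t2_flow \<alpha> \<beta> \<gamma> \<delta> k H s (X\<^sub>2 s)) \<longrightarrow>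
       (\<forall>s. smooth_fields s \<longrightarrow> constraints \<alpha> \<beta> \<gamma> \<delta> s \<longrightarrow> (\<forall>n y.
          time_deriv X\<^sub>2 (time_deriv X\<^sub>1 (\<lambda>s. q s n y)) s
            = time_deriv X\<^sub>1 (time_deriv X\<^sub>2 (\<lambda>s. q s n y)) s \<and>
          time_deriv X\<^sub>2 (time_deriv X\<^sub>1 (\<lambda>s. r s n y)) s
            = time_deriv X\<^sub>1 (time_deriv X\<^sub>2 (\<lambda>s. r s n y)) s)))"

text \<open>Solutions of the whole system as functions of \<open>n\<close>, \<open>y\<close>, \<open>t\<^sub>1\<close>, \<open>t\<^sub>2\<close>; here
  \<open>S t\<^sub>1 t\<^sub>2\<close> are the fields at time \<open>(t\<^sub>1, t\<^sub>2)\<close>.\<close>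

definition fields_pd :: "(real \<Rightarrow> 'm::finite fields) \<Rightarrow> real \<Rightarrow> 'm fields" where
  "fields_pd S t =
     \<lparr> q = \<lambda>n y. pd (\<lambda>\<tau>. q (S \<tau>) n y) t,
       r = \<lambda>n y. pd (\<lambda>\<tau>. r (S \<tau>) n y) t,
       logu = \<lambda>n y. pd (\<lambda>\<tau>. logu (S \<tau>) n y) t,
       v = \<lambda>n y. pd (\<lambda>\<tau>. v (S \<tau>) n y) t,
       w = \<lambda>n y. pd (\<lambda>\<tau>. w (S \<tau>) n y) t \<rparr>"

definition solution ::
  "complex \<Rightarrow> complex \<Rightarrow> complex \<Rightarrow> complex \<Rightarrow> complex
    \<Rightarrow> (real \<Rightarrow> real \<Rightarrow> real \<Rightarrow> complex^'m^'m) \<Rightarrow> (int \<Rightarrow> real \<Rightarrow> real \<Rightarrow> complex)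
    \<Rightarrow> (real \<Rightarrow> real \<Rightarrow> 'm::finite fields) \<Rightarrow> bool" where
  "solution \<alpha> \<beta> \<gamma> \<delta> k F H S \<longleftrightarrow>
     (\<forall>n. smooth (\<lambda>(y, t\<^sub>1, t\<^sub>2). q (S t\<^sub>1 t\<^sub>2) n y) \<and> smooth (\<lambda>(y, t\<^sub>1, t\<^sub>2). r (S t\<^sub>1 t\<^sub>2) n y) \<and>
          smooth (\<lambda>(y, t\<^sub>1, t\<^sub>2). logu (S t\<^sub>1 t\<^sub>2) n y) \<and> smooth (\<lambda>(y, t\<^sub>1, t\<^sub>2). v (S t\<^sub>1 t\<^sub>2) n y) \<and>
          smooth (\<lambda>(y, t\<^sub>1, t\<^sub>2). w (S t\<^sub>1 t\<^sub>2) n y)) \<and>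
     (\<forall>t\<^sub>1 t\<^sub>2.
        constraints \<alpha> \<beta> \<gamma> \<delta> (S t\<^sub>1 t\<^sub>2) \<and>
        t1_flow \<alpha> \<beta> \<gamma> \<delta> (\<lambda>y. F y t\<^sub>1 t\<^sub>2) (S t\<^sub>1 t\<^sub>2) (fields_pd (\<lambda>\<tau>. S \<tau> t\<^sub>2) t\<^sub>1) \<and>
        t2_flow \<alpha> \<beta> \<gamma> \<delta> k (\<lambda>n. H n t\<^sub>1 t\<^sub>2) (S t\<^sub>1 t\<^sub>2) (fields_pd (\<lambda>\<tau>. S t\<^sub>1 \<tau>) t\<^sub>2))"

definition double_antiderivative ::
  "(real \<Rightarrow> real \<Rightarrow> complex) \<Rightarrow> (real \<Rightarrow> real \<Rightarrow> complex) \<Rightarrow> bool" where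
  "double_antiderivative h \<Phi> \<longleftrightarrow> smooth (\<lambda>(t\<^sub>1, t\<^sub>2). \<Phi> t\<^sub>1 t\<^sub>2) \<and>
     (\<forall>t\<^sub>1 t\<^sub>2. pd (\<lambda>\<tau>. pd (\<lambda>\<sigma>. \<Phi> \<sigma> \<tau>) t\<^sub>1) t\<^sub>2 = h t\<^sub>1 t\<^sub>2)"

text \<open>The change of dependent variables from \<open>S\<close> (the variables with a tilde) to the original
  ones. The time-dependent phase of \<open>q\<close>, \<open>r\<close> is accompanied by shifts of the auxiliary
  variables \<open>v\<^sub>n\<close>, \<open>w\<^sub>n\<close> by quantities \<open>a I\<close>, \<open>b\<close> independent of \<open>n\<close> and \<open>y\<close>.\<close>

definition phase_change ::
  "complex \<Rightarrow> (real \<Rightarrow> real \<Rightarrow> complex) \<Rightarrow> (real \<Rightarrow> real \<Rightarrow> complex) \<Rightarrow> (real \<Rightarrow> real \<Rightarrow> complex)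
    \<Rightarrow> (real \<Rightarrow> real \<Rightarrow> 'm::finite fields) \<Rightarrow> real \<Rightarrow> real \<Rightarrow> 'm fields" where
  "phase_change k \<Phi> a b S t\<^sub>1 t\<^sub>2 =
     \<lparr> q = \<lambda>n y. exp (- (\<i> / k) * \<Phi> t\<^sub>1 t\<^sub>2) *s q (S t\<^sub>1 t\<^sub>2) n y,
       r = \<lambda>n y. exp (\<i> / k * \<Phi> t\<^sub>1 t\<^sub>2) *s r (S t\<^sub>1 t\<^sub>2) n y,
       logu = logu (S t\<^sub>1 t\<^sub>2),
       v = \<lambda>n y. v (S t\<^sub>1 t\<^sub>2) n y + mat (a t\<^sub>1 t\<^sub>2),
       w = \<lambda>n y. w (S t\<^sub>1 t\<^sub>2) n y + b t\<^sub>1 t\<^sub>2 \<rparr>"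

end

theory Submission
  imports Defs
begin

text \<open>By the constraints, both second derivatives of \<open>q\<^sub>n\<close> can be written through \<open>q\<close>,
  \<open>r\<close> and their \<open>y\<close>-derivatives at \<open>n - 1, n, n + 1\<close>;
  everything cancels except \<open>\<i>k (q\<^sub>n\<^sub>,\<^sub>t\<^sub>1\<^sub>t\<^sub>2 - q\<^sub>n\<^sub>,\<^sub>t\<^sub>2\<^sub>t\<^sub>1) = q\<^sub>n ((\<gamma> + \<delta>) F + H\<^sub>n I)\<close>, and dually for \<open>r\<^sub>n\<close>.
  For the necessity of the condition this is evaluated at \<open>r = 0\<close>, \<open>q\<close> a constant basis vector.
  The phase change with double antiderivative \<open>\<Phi>\<close> shifts \<open>v\<close> by \<open>\<i> \<Phi>\<^sub>t\<^sub>2 / (\<gamma> + \<delta>)\<close> and \<open>w\<close> by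
  \<open>\<Phi>\<^sub>t\<^sub>1 / k\<close>; differentiating these shifts produces exactly the constants \<open>F\<close> and \<open>H\<close>, once the mixed
  partial derivatives of \<open>\<Phi>\<close> are known to agree.\<close>

section \<open>Smooth functions\<close>

text \<open>The vector fields in \<open>time_derivs_commute\<close> are known only through the flow
  equations, and neither flow prescribes all components. This is enough because the two flows fit
  together: \<open>q\<close> under the first flow is driven by \<open>q\<close>, \<open>logu\<close>
  and \<open>w\<close>, whose derivatives in the second time are all prescribed, and
  \<open>q\<close> under the second flow by \<open>q\<close>, \<open>r\<close> and \<open>v\<close>,
  whose derivatives in the first time are all prescribed. The constants of integration therefore
  enter at one place each: \<open>H n\<close> through the derivative of \<open>w\<close> in the
  product of \<open>w\<close> and \<open>q\<close>, and \<open>F\<close> through the derivatives of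
  \<open>v\<close> at \<open>n\<close> and \<open>n+1\<close>, weighted by \<gamma> and \<delta>,
  which produces \<gamma> + \<delta>. The constraints determine the matrix \<open>v\<close> only up
  to its value at one site, so that value stays an unknown that has to cancel. The phase change, by
  contrast, concerns genuine functions of \<open>y\<close> and both times, and a smooth double
  antiderivative has to be constructed as well; this is why \<open>smooth\<close> must be closed
  under compositions and integrals with a parameter.\<close>

lemma k_times_diff_SucI:
  assumes "\<And>x. (f has_derivative f' x) (at x)" "\<And>h. k_times_diff m (\<lambda>x. f' x h)"
  shows "k_times_diff (Suc m) f"
proof -
  have "frechet_derivative f (at x) = f' x" for x
    using frechet_derivative_at[OF assms(1)] by simp
  then show ?thesis
    using assms by (auto simp: differentiable_def)
qed

text \<open>Together with \<open>k_times_diff_SucI\<close> this removes the choice made by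
  \<open>frechet_derivative\<close>: derivatives are unique, so any explicit family may be used, and
  the inductions below can quote the sum, product and chain rules directly.\<close>

lemma k_times_diff_SucE:
  assumes "k_times_diff (Suc m) f"
  obtains f' where "\<And>x. (f has_derivative f' x) (at x)" "\<And>h. k_times_diff m (\<lambda>x. f' x h)"
  using assms that[of "\<lambda>x. frechet_derivative f (at x)"]
  by (simp add: frechet_derivative_works[symmetric])

text \<open>The derivative of a product or a composition still contains undifferentiated factors;
  this lowers their order to the one of the induction hypothesis.\<close>

lemma k_times_diff_pred: "k_times_diff (Suc m) f \<Longrightarrow> k_times_diff m f"
proof (induction m arbitrary: f)
  case 0
  then show ?case
    by (auto simp: continuous_on_eq_continuous_within differentiable_imp_continuous_within)
next
  case (Suc m)
  have "\<And>x. f differentiable (at x)" and "\<And>h. k_times_diff (Suc m) (\<lambda>x. frechet_derivative f (at x) h)"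
    using Suc.prems unfolding k_times_diff.simps(2)[of "Suc m"] by blast+
  with Suc.IH show ?case by (simp only: k_times_diff.simps(2)) blast
qed

lemma k_times_diff_const: "k_times_diff m (\<lambda>x. c)"
  by (induction m arbitrary: c) auto

lemma k_times_diff_add:
  "k_times_diff m f \<Longrightarrow> k_times_diff m g \<Longrightarrow> k_times_diff m (\<lambda>x. f x + g x)"
proof (induction m arbitrary: f g)
  case 0
  then show ?case by (auto intro: continuous_intros)
next
  case (Suc m)
  from Suc.prems(1) obtain f' where f:
    "\<And>x. (f has_derivative f' x) (at x)" "\<And>h. k_times_diff m (\<lambda>x. f' x h)"
    by (rule k_times_diff_SucE) blast
  from Suc.prems(2) obtain g' where g:
    "\<And>x. (g has_derivative g' x) (at x)" "\<And>h. k_times_diff m (\<lambda>x. g' x h)"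
    by (rule k_times_diff_SucE) blast
  show ?case
    by (rule k_times_diff_SucI[OF has_derivative_add[OF f(1) g(1)]]) (intro Suc.IH f g)
qed

lemma k_times_diff_bilinear:
  assumes B: "bounded_bilinear B"
  shows "k_times_diff m f \<Longrightarrow> k_times_diff m g \<Longrightarrow> k_times_diff m (\<lambda>x. B (f x) (g x))"
proof (induction m arbitrary: f g)
  case 0
  then show ?case by (auto intro: bounded_bilinear.continuous_on[OF B])
next
  case (Suc m)
  from Suc.prems(1) obtain f' where f:
    "\<And>x. (f has_derivative f' x) (at x)" "\<And>h. k_times_diff m (\<lambda>x. f' x h)"
    by (rule k_times_diff_SucE) blast
  from Suc.prems(2) obtain g' where g:
    "\<And>x. (g has_derivative g' x) (at x)" "\<And>h. k_times_diff m (\<lambda>x. g' x h)"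
    by (rule k_times_diff_SucE) blast
  show ?case
    by (rule k_times_diff_SucI[OF bounded_bilinear.FDERIV[OF B f(1) g(1)]])
      (intro k_times_diff_add Suc.IH f g k_times_diff_pred[OF Suc.prems(1)]
        k_times_diff_pred[OF Suc.prems(2)])
qed

lemma k_times_diff_linear:
  assumes L: "bounded_linear L"
  shows "k_times_diff m f \<Longrightarrow> k_times_diff m (\<lambda>x. L (f x))"
proof (induction m arbitrary: f)
  case 0
  then show ?case by (auto intro: bounded_linear.continuous_on[OF L])
next
  case (Suc m)
  from Suc.prems(1) obtain f' where f:
    "\<And>x. (f has_derivative f' x) (at x)" "\<And>h. k_times_diff m (\<lambda>x. f' x h)"
    by (rule k_times_diff_SucE) blast
  show ?case
    by (rule k_times_diff_SucI[OF bounded_linear.has_derivative[OF L f(1)]]) (intro Suc.IH f)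
qed

lemma k_times_diff_sum:
  "(\<And>i. i \<in> I \<Longrightarrow> k_times_diff m (f i)) \<Longrightarrow> k_times_diff m (\<lambda>x. \<Sum>i\<in>I. f i x)"
  by (induction I rule: infinite_finite_induct) (auto intro: k_times_diff_const k_times_diff_add)

text \<open>\<open>k_times_diff\<close> controls derivatives in fixed directions, while the chain
  rule evaluates \<open>f'\<close> in the direction \<open>g' x h\<close>, which varies with
  \<open>x\<close>. Expanding this direction in the finite basis of the middle space gives a sum of
  products with fixed directions \<open>b\<close>, to which the induction hypothesis
  applies.\<close>

lemma k_times_diff_compose:
  fixes f :: "'b::euclidean_space \<Rightarrow> 'c::real_normed_vector"
    and g :: "'a::real_normed_vector \<Rightarrow> 'b"
  shows "k_times_diff m f \<Longrightarrow> k_times_diff m g \<Longrightarrow> k_times_diff m (\<lambda>x. f (g x))"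
proof (induction m arbitrary: f g)
  case 0
  then show ?case
    by (auto intro: continuous_on_compose2[of UNIV f])
next
  case (Suc m)
  from Suc.prems(1) obtain f' where f:
    "\<And>x. (f has_derivative f' x) (at x)" "\<And>h. k_times_diff m (\<lambda>x. f' x h)"
    by (rule k_times_diff_SucE) blast
  from Suc.prems(2) obtain g' where g:
    "\<And>x. (g has_derivative g' x) (at x)" "\<And>h. k_times_diff m (\<lambda>x. g' x h)"
    by (rule k_times_diff_SucE) blast
  have "f' (g x) (g' x h) = (\<Sum>b\<in>Basis. (g' x h \<bullet> b) *\<^sub>R f' (g x) b)" for x h
  proof -
    have lin: "linear (f' (g x))"
      using f(1) has_derivative_linear by blast
    have "f' (g x) (g' x h) = f' (g x) (\<Sum>b\<in>Basis. (g' x h \<bullet> b) *\<^sub>R b)"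
      by (simp add: euclidean_representation)
    also have "\<dots> = (\<Sum>b\<in>Basis. (g' x h \<bullet> b) *\<^sub>R f' (g x) b)"
      by (simp add: linear_sum[OF lin] linear_cmul[OF lin])
    finally show ?thesis .
  qed
  then have "((\<lambda>x. f (g x)) has_derivative
      (\<lambda>h. \<Sum>b\<in>Basis. (g' x h \<bullet> b) *\<^sub>R f' (g x) b)) (at x)" for x
    using has_derivative_compose[OF g(1) f(1), of x] by simp
  then show ?case
    by (rule k_times_diff_SucI)
      (intro k_times_diff_sum k_times_diff_bilinear[OF bounded_bilinear_scaleR]
        k_times_diff_linear[OF bounded_linear_inner_left] Suc.IH f g k_times_diff_pred[OF Suc.prems(2)])
qed

lemma k_times_diff_exp:
  fixes f :: "'a::real_normed_vector \<Rightarrow> complex"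
  shows "k_times_diff m f \<Longrightarrow> k_times_diff m (\<lambda>x. exp (f x))"
proof (induction m arbitrary: f)
  case 0
  then show ?case by (auto intro: continuous_intros)
next
  case (Suc m)
  from Suc.prems(1) obtain f' where f:
    "\<And>x. (f has_derivative f' x) (at x)" "\<And>h. k_times_diff m (\<lambda>x. f' x h)"
    by (rule k_times_diff_SucE) blast
  have "((\<lambda>x. exp (f x)) has_derivative (\<lambda>h. exp (f x) * f' x h)) (at x)" for x
    using has_derivative_compose[OF f(1) DERIV_exp[THEN has_field_derivative_imp_has_derivative]]
    by simp
  then show ?case
    by (rule k_times_diff_SucI)
      (intro k_times_diff_bilinear[OF bounded_bilinear_mult] Suc.IH f k_times_diff_pred[OF Suc.prems])
qed

section \<open>Integrals depending on a parameter\<close>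

lemma has_derivative_integral_param:
  fixes f :: "'a::euclidean_space \<times> real \<Rightarrow> 'b::banach"
  assumes f: "\<And>z. (f has_derivative f' z) (at z)"
    and f': "\<And>h. continuous_on UNIV (\<lambda>z. f' z h)"
  shows "((\<lambda>p. integral {0..1} (\<lambda>t. f (p, t))) has_derivative
    (\<lambda>h. integral {0..1} (\<lambda>t. f' (p, t) (h, 0)))) (at p)"
proof -
  \<comment> \<open>\<open>leibniz_rule\<close> asks for a continuous family of bounded linear maps.
    On a Euclidean parameter space this follows from continuity in each fixed direction, which is
    what \<open>f'\<close> states.\<close>
  define fx where "fx = (\<lambda>p t. Blinfun (\<lambda>h. f' (p, t) (h, 0)))"
  have part: "((\<lambda>p. f (p, t)) has_derivative (\<lambda>h. f' (p, t) (h, 0))) (at p)" for p t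
    by (rule has_derivative_compose[OF _ f, of "\<lambda>p. (p, t)" "\<lambda>h. (h, 0)"])
      (auto intro!: derivative_eq_intros)
  have apply_fx: "blinfun_apply (fx p t) = (\<lambda>h. f' (p, t) (h, 0))" for p t
    unfolding fx_def using part has_derivative_bounded_linear bounded_linear_Blinfun_apply by blast
  have cf: "continuous_on UNIV f"
    by (rule has_derivative_continuous_on[OF has_derivative_at_withinI[OF f]])
  have cont: "continuous_on (UNIV \<times> cbox 0 1) (\<lambda>(p, t). fx p t)"
    by (rule continuous_on_blinfun_componentwise)
      (auto simp: apply_fx split_beta intro: continuous_on_subset[OF f'])
  have der: "((\<lambda>p. integral (cbox 0 1) (\<lambda>t. f (p, t))) has_derivative integral (cbox 0 1) (fx p)) (at p within UNIV)"
  proof (rule leibniz_rule[OF _ _ cont])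
    show "(\<lambda>t. f (p, t)) integrable_on cbox 0 1" for p
      by (intro integrable_continuous continuous_on_compose2[OF cf] continuous_intros) auto
  qed (auto simp: apply_fx part)
  have "blinfun_apply (integral (cbox 0 1) (fx p)) h = integral {0..1} (\<lambda>t. f' (p, t) (h, 0))" for h
  proof -
    have "continuous_on (cbox 0 1) (fx p)"
      using continuous_on_compose2[OF cont, of "cbox 0 1" "\<lambda>t. (p, t)"]
      by (force intro!: continuous_intros)
    then show ?thesis
      by (subst blinfun_apply_integral) (auto simp: apply_fx intro: integrable_continuous_interval)
  qed
  then have "blinfun_apply (integral (cbox 0 1) (fx p)) = (\<lambda>h. integral {0..1} (\<lambda>t. f' (p, t) (h, 0)))"
    by (rule ext)
  with der show ?thesis by simp
qed

text \<open>Differentiation under the integral sign uses only the directions \<open>(h, 0)\<close>,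
  so the derivative is again a parameter integral, of a function of one order less.\<close>

lemma k_times_diff_integral:
  fixes f :: "'a::euclidean_space \<times> real \<Rightarrow> 'b::banach"
  shows "k_times_diff m f \<Longrightarrow> k_times_diff m (\<lambda>p. integral {0..1} (\<lambda>t. f (p, t)))"
proof (induction m arbitrary: f)
  case 0
  then show ?case
    using integral_continuous_on_param[of UNIV 0 1 "\<lambda>p t. f (p, t)"]
    by (auto intro: continuous_on_subset)
next
  case (Suc m)
  from Suc.prems(1) obtain f' where f:
    "\<And>x. (f has_derivative f' x) (at x)" "\<And>h. k_times_diff m (\<lambda>x. f' x h)"
    by (rule k_times_diff_SucE) blast
  have "continuous_on UNIV (\<lambda>z. f' z h)" for h
    using f(2)[of h] by (cases m) (auto simp: continuous_on_eq_continuous_within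
        differentiable_imp_continuous_within)
  from has_derivative_integral_param[OF f(1) this] show ?case
    by (rule k_times_diff_SucI) (intro Suc.IH f)
qed

lemma smooth_k: "smooth f \<Longrightarrow> k_times_diff m f"
  by (simp add: smooth_def)

lemma smooth_continuous: "smooth f \<Longrightarrow> continuous_on UNIV f"
  using smooth_k[of f 0] by simp

lemma smooth_integral:
  fixes f :: "'a::euclidean_space \<times> real \<Rightarrow> 'b::banach"
  shows "smooth f \<Longrightarrow> smooth (\<lambda>p. integral {0..1} (\<lambda>t. f (p, t)))"
  by (simp add: smooth_def k_times_diff_integral)

lemma smooth_const [simp, intro]: "smooth (\<lambda>x. c)"
  by (simp add: smooth_def k_times_diff_const)

lemma smooth_add: "smooth f \<Longrightarrow> smooth g \<Longrightarrow> smooth (\<lambda>x. f x + g x)"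
  by (simp add: smooth_def k_times_diff_add)

lemma smooth_bilinear: "bounded_bilinear B \<Longrightarrow> smooth f \<Longrightarrow> smooth g \<Longrightarrow> smooth (\<lambda>x. B (f x) (g x))"
  by (simp add: smooth_def k_times_diff_bilinear)

lemma smooth_linear: "bounded_linear L \<Longrightarrow> smooth f \<Longrightarrow> smooth (\<lambda>x. L (f x))"
  by (simp add: smooth_def k_times_diff_linear)

lemma smooth_compose:
  fixes f :: "'b::euclidean_space \<Rightarrow> 'c::real_normed_vector"
  shows "smooth f \<Longrightarrow> smooth g \<Longrightarrow> smooth (\<lambda>x. f (g x))"
  by (simp add: smooth_def k_times_diff_compose)

lemma smooth_exp: "smooth f \<Longrightarrow> smooth (\<lambda>x. exp (f x) :: complex)"
  by (simp add: smooth_def k_times_diff_exp)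

lemma smooth_minus: "smooth f \<Longrightarrow> smooth (\<lambda>x. - f x)"
  by (rule smooth_linear[OF bounded_linear_minus[OF bounded_linear_ident]])

lemma smooth_diff: "smooth f \<Longrightarrow> smooth g \<Longrightarrow> smooth (\<lambda>x. f x - g x)"
  using smooth_add[OF _ smooth_minus] by fastforce

lemma smooth_mult: "smooth f \<Longrightarrow> smooth g \<Longrightarrow> smooth (\<lambda>x. f x * g x :: 'a::real_normed_algebra)"
  by (rule smooth_bilinear[OF bounded_bilinear_mult])

lemma smooth_power: "smooth f \<Longrightarrow> smooth (\<lambda>x. f x ^ n :: 'a::real_normed_algebra_1)"
  by (induction n) (auto intro: smooth_mult)

lemma smooth_id: "smooth (\<lambda>x::'a::real_normed_vector. x)"
proof -
  have "k_times_diff m (\<lambda>x::'a. x)" for m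
    by (cases m) (auto simp: k_times_diff_const)
  then show ?thesis by (simp add: smooth_def)
qed

lemma smooth_fst: "smooth f \<Longrightarrow> smooth (\<lambda>x. fst (f x))"
  by (rule smooth_linear[OF bounded_linear_fst])

lemma smooth_snd: "smooth f \<Longrightarrow> smooth (\<lambda>x. snd (f x))"
  by (rule smooth_linear[OF bounded_linear_snd])

lemma smooth_Pair: "smooth f \<Longrightarrow> smooth g \<Longrightarrow> smooth (\<lambda>x. (f x, g x))"
proof -
  assume "smooth f" "smooth g"
  moreover have "bounded_linear (\<lambda>x::'b. (x, 0::'c))" "bounded_linear (\<lambda>x::'c. (0::'b, x))"
    by (auto intro: bounded_linear_Pair)
  ultimately have "smooth (\<lambda>x. (f x, 0) + (0, g x))"
    by (intro smooth_add smooth_linear[of "\<lambda>x::'b. (x, 0::'c)"] smooth_linear[of "\<lambda>x::'c. (0::'b, x)"])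
  then show ?thesis by simp
qed

lemma smooth_scaleR: "smooth f \<Longrightarrow> smooth g \<Longrightarrow> smooth (\<lambda>x. f x *\<^sub>R g x)"
  by (rule smooth_bilinear[OF bounded_bilinear_scaleR])

lemmas smooth_intros = smooth_const smooth_id smooth_add smooth_minus smooth_diff smooth_mult
  smooth_power smooth_fst smooth_snd smooth_Pair smooth_scaleR smooth_exp

section \<open>Directional derivatives, antiderivatives and mixed partial derivatives\<close>

definition dir_deriv :: "'a::real_normed_vector \<Rightarrow> ('a \<Rightarrow> 'b::real_normed_vector) \<Rightarrow> 'a \<Rightarrow> 'b" where
  "dir_deriv h f x = frechet_derivative f (at x) h"

lemma smooth_has_derivative: "smooth f \<Longrightarrow> (f has_derivative (\<lambda>h. dir_deriv h f x)) (at x)"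
  using smooth_k[of f "Suc 0"] by (simp add: dir_deriv_def frechet_derivative_works)

lemma smooth_dir_deriv: "smooth f \<Longrightarrow> smooth (dir_deriv h f)"
  unfolding smooth_def
proof
  fix m
  assume "\<forall>m. k_times_diff m f"
  then have "k_times_diff (Suc m) f" by blast
  then show "k_times_diff m (dir_deriv h f)"
    by (simp add: dir_deriv_def[abs_def])
qed

lemma dir_deriv_eq: "(f has_derivative f') (at x) \<Longrightarrow> dir_deriv h f x = f' h"
  using frechet_derivative_at[of f f' x] by (simp add: dir_deriv_def)

lemma smooth_has_pd: "smooth f \<Longrightarrow> (f has_vector_derivative pd f x) (at x)"
  using smooth_k[of f "Suc 0"] by (simp add: vector_derivative_works[symmetric])

lemma pd_eq: "(f has_vector_derivative d) (at x) \<Longrightarrow> pd f x = d"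
  by (rule vector_derivative_at)

lemma pd_eq_dir_deriv: "smooth f \<Longrightarrow> pd f = dir_deriv 1 f"
  by (rule ext) (simp add: dir_deriv_eq[OF smooth_has_pd[unfolded has_vector_derivative_def]])

lemma smooth_pd: "smooth f \<Longrightarrow> smooth (pd f)"
  by (simp add: pd_eq_dir_deriv smooth_dir_deriv)

lemma smooth_has_partials:
  fixes f :: "real \<times> real \<Rightarrow> 'a::real_normed_vector"
  assumes "smooth f"
  shows "((\<lambda>s. f (s, y)) has_vector_derivative dir_deriv (1, 0) f (x, y)) (at x)"
    and "((\<lambda>s. f (x, s)) has_vector_derivative dir_deriv (0, 1) f (x, y)) (at y)"
proof -
  have lin: "linear (\<lambda>h. dir_deriv h f (x, y))"
    using smooth_has_derivative[OF assms] has_derivative_linear by blast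
  have "((\<lambda>s. f (s, y)) has_derivative (\<lambda>h. dir_deriv (h, 0) f (x, y))) (at x)"
    by (rule has_derivative_compose[OF _ smooth_has_derivative[OF assms], of "\<lambda>p. (p, y)" "\<lambda>h. (h, 0)"])
      (auto intro!: derivative_eq_intros)
  then show "((\<lambda>s. f (s, y)) has_vector_derivative dir_deriv (1, 0) f (x, y)) (at x)"
    using linear_cmul[OF lin, of _ "(1, 0)", symmetric] by (simp add: has_vector_derivative_def)
  have "((\<lambda>s. f (x, s)) has_derivative (\<lambda>h. dir_deriv (0, h) f (x, y))) (at y)"
    by (rule has_derivative_compose[OF _ smooth_has_derivative[OF assms], of "\<lambda>p. (x, p)" "\<lambda>h. (0, h)"])
      (auto intro!: derivative_eq_intros)
  then show "((\<lambda>s. f (x, s)) has_vector_derivative dir_deriv (0, 1) f (x, y)) (at y)"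
    using linear_cmul[OF lin, of _ "(0, 1)", symmetric] by (simp add: has_vector_derivative_def)
qed

text \<open>The integral of \<open>f (s, y)\<close> over \<open>s\<close> from 0 to
  \<open>x\<close>, rescaled by \<open>s = t * x\<close> to a fixed interval: smoothness in both
  variables then comes from integration with a parameter, with no variable endpoint.\<close>

definition antideriv :: "(real \<times> real \<Rightarrow> 'a::banach) \<Rightarrow> real \<times> real \<Rightarrow> 'a" where
  "antideriv f p = fst p *\<^sub>R integral {0..1} (\<lambda>t. f (t * fst p, snd p))"

lemma smooth_stretch:
  fixes f :: "real \<times> real \<Rightarrow> 'a::banach"
  assumes "smooth f"
  shows "smooth (\<lambda>z::(real \<times> real) \<times> real. f (snd z * fst (fst z), snd (fst z)))"
  by (rule smooth_compose[OF assms]) (intro smooth_intros)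

lemma smooth_antideriv: "smooth f \<Longrightarrow> smooth (antideriv f)"
  unfolding antideriv_def[abs_def]
  using smooth_integral[OF smooth_stretch] by (intro smooth_intros) simp

lemma antideriv_has_derivative:
  fixes f :: "real \<times> real \<Rightarrow> 'a::banach"
  assumes f: "smooth f"
  shows "(antideriv f has_derivative (\<lambda>h. fst h *\<^sub>R integral {0..1} (\<lambda>t. f (t * fst p, snd p)) +
    fst p *\<^sub>R integral {0..1} (\<lambda>t. dir_deriv (t * fst h, snd h) f (t * fst p, snd p)))) (at p)"
proof -
  let ?g = "\<lambda>z::(real \<times> real) \<times> real. f (snd z * fst (fst z), snd (fst z))"
  have g: "smooth ?g" by (rule smooth_stretch[OF f])
  have dg: "dir_deriv (h, 0) ?g (p, t) = dir_deriv (t * fst h, snd h) f (t * fst p, snd p)" for h t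
  proof -
    have "((\<lambda>z::(real \<times> real) \<times> real. (snd z * fst (fst z), snd (fst z))) has_derivative
      (\<lambda>k. (t * fst (fst k) + snd k * fst p, snd (fst k)))) (at (p, t))"
      by (auto intro!: derivative_eq_intros)
    from has_derivative_compose[OF this, OF smooth_has_derivative[OF f]]
    have "dir_deriv k ?g (p, t) = dir_deriv (t * fst (fst k) + snd k * fst p, snd (fst k)) f (t * fst p, snd p)" for k
      by (intro dir_deriv_eq) simp
    then show ?thesis by simp
  qed
  have "((\<lambda>p. integral {0..1} (\<lambda>t. ?g (p, t))) has_derivative
    (\<lambda>h. integral {0..1} (\<lambda>t. dir_deriv (h, 0) ?g (p, t)))) (at p)"
    by (intro has_derivative_integral_param smooth_has_derivative smooth_continuous smooth_dir_deriv g)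
  then have "((\<lambda>p. integral {0..1} (\<lambda>t. f (t * fst p, snd p))) has_derivative
    (\<lambda>h. integral {0..1} (\<lambda>t. dir_deriv (t * fst h, snd h) f (t * fst p, snd p)))) (at p)"
    by (simp add: dg)
  then show ?thesis
    unfolding antideriv_def[abs_def] by (auto intro!: derivative_eq_intros)
qed

text \<open>In the first variable, the two terms of the product rule combine to the integral over
  \<open>t\<close> of the derivative of \<open>t *\<^sub>R f (t * x, y)\<close>, whose boundary
  value is \<open>f (x, y)\<close>. In the second, differentiation passes under the integral
  sign.\<close>

lemma dir_deriv_antideriv:
  fixes f :: "real \<times> real \<Rightarrow> 'a::banach"
  assumes f: "smooth f"
  shows "dir_deriv (1, 0) (antideriv f) p = f p"
    and "dir_deriv (0, 1) (antideriv f) p = antideriv (dir_deriv (0, 1) f) p"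
proof -
  note d = dir_deriv_eq[OF antideriv_has_derivative[OF f]]
  show "dir_deriv (0, 1) (antideriv f) p = antideriv (dir_deriv (0, 1) f) p"
    by (simp add: d antideriv_def)
  let ?x = "fst p" and ?y = "snd p"
  have lin: "linear (\<lambda>h. dir_deriv h f z)" for z
    using smooth_has_derivative[OF f] has_derivative_linear by blast
  have c: "continuous_on UNIV f" "continuous_on UNIV (dir_deriv (1, 0) f)"
    by (intro smooth_continuous smooth_dir_deriv f)+
  have sc: "c *\<^sub>R dir_deriv (t, 0) f z = dir_deriv (c * t, 0) f z" for c t z
    using linear_cmul[OF lin, of c "(t, 0)", symmetric] by simp
  \<comment> \<open>By linearity in the direction, \<open>dir_deriv (t, 0) f\<close> is
    \<open>t\<close> times the first partial derivative, as the chain rule requires.\<close>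
  have der: "((\<lambda>t. t *\<^sub>R f (t * ?x, ?y)) has_vector_derivative
      f (t * ?x, ?y) + ?x *\<^sub>R dir_deriv (t, 0) f (t * ?x, ?y)) (at t within {0..1})" for t
  proof -
    have "((\<lambda>t. f (t * ?x, ?y)) has_vector_derivative ?x *\<^sub>R dir_deriv (1, 0) f (t * ?x, ?y)) (at t)"
      using vector_diff_chain_at[OF _ smooth_has_partials(1)[OF f], of "\<lambda>t. t * ?x" ?x t ?y]
      by (force intro!: derivative_eq_intros simp: o_def)
    then have "((\<lambda>t. t *\<^sub>R f (t * ?x, ?y)) has_vector_derivative
      f (t * ?x, ?y) + ?x *\<^sub>R dir_deriv (t, 0) f (t * ?x, ?y)) (at t)"
      by (auto intro!: derivative_eq_intros simp: sc mult.commute)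
    then show ?thesis by (rule has_vector_derivative_at_within)
  qed
  have "integral {0..1} (\<lambda>t. f (t * ?x, ?y) + ?x *\<^sub>R dir_deriv (t, 0) f (t * ?x, ?y)) = f p"
    using fundamental_theorem_of_calculus[of 0 1, OF _ der] by (simp add: integral_unique)
  moreover have "integral {0..1} (\<lambda>t. f (t * ?x, ?y) + ?x *\<^sub>R dir_deriv (t, 0) f (t * ?x, ?y))
    = integral {0..1} (\<lambda>t. f (t * ?x, ?y)) + integral {0..1} (\<lambda>t. ?x *\<^sub>R dir_deriv (t, 0) f (t * ?x, ?y))"
  proof (intro Henstock_Kurzweil_Integration.integral_add integrable_continuous_interval)
    show "continuous_on {0..1} (\<lambda>t. f (t * ?x, ?y))"
      by (intro continuous_intros continuous_on_compose2[OF c(1)]) auto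
    have "continuous_on {0..1} (\<lambda>t. (?x * t) *\<^sub>R dir_deriv (1, 0) f (t * ?x, ?y))"
      by (intro continuous_intros continuous_on_compose2[OF c(2)]) auto
    then show "continuous_on {0..1} (\<lambda>t. ?x *\<^sub>R dir_deriv (t, 0) f (t * ?x, ?y))"
      by (simp add: sc)
  qed
  ultimately show "dir_deriv (1, 0) (antideriv f) p = f p"
    by (simp add: d)
qed

lemma dir_deriv_diff:
  "smooth f \<Longrightarrow> smooth g \<Longrightarrow> dir_deriv h (\<lambda>x. f x - g x) x = dir_deriv h f x - dir_deriv h g x"
  by (intro dir_deriv_eq has_derivative_diff smooth_has_derivative)

text \<open>Subtracting from \<open>f\<close> the integral of its first partial derivative leaves a function of the second
  variable only; for the integral, the equality is differentiation under the integral sign.\<close>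

lemma mixed_partials:
  fixes f :: "real \<times> real \<Rightarrow> 'a::banach"
  assumes f: "smooth f"
  shows "dir_deriv (1, 0) (dir_deriv (0, 1) f) p = dir_deriv (0, 1) (dir_deriv (1, 0) f) p"
proof -
  define P where "P = antideriv (dir_deriv (1, 0) f)"
  define c where "c = (\<lambda>x. f x - P x)"
  have P: "smooth P" unfolding P_def by (intro smooth_antideriv smooth_dir_deriv f)
  have c: "smooth c" unfolding c_def by (intro smooth_intros f P)
  have "dir_deriv (1, 0) c x = 0" for x
    by (simp add: c_def P_def dir_deriv_diff dir_deriv_antideriv smooth_antideriv smooth_dir_deriv f)
  then have "((\<lambda>s. c (s, y)) has_vector_derivative 0) (at x)" for x y
    using smooth_has_partials(1)[OF c, of y x] by simp
  then have c0: "c (x, y) = c (0, y)" for x y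
    by (intro has_derivative_zero_unique[of UNIV "\<lambda>s. c (s, y)" 0 x, symmetric])
      (auto simp: has_vector_derivative_def)
  have c1: "dir_deriv (0, 1) c (x, y) = dir_deriv (0, 1) c (0, y)" for x y
  proof -
    have "(\<lambda>s. c (x, s)) = (\<lambda>s. c (0, s))"
      using c0 by (intro ext)
    then show ?thesis
      using vector_derivative_unique_at smooth_has_partials(2)[OF c, of x y]
        smooth_has_partials(2)[OF c, of 0 y] by simp
  qed
  have "((\<lambda>s. dir_deriv (0, 1) c (s, y)) has_vector_derivative 0) (at x)" for x y
    by (subst c1) (rule has_vector_derivative_const)
  then have z: "dir_deriv (1, 0) (dir_deriv (0, 1) c) p = 0"
    using smooth_has_partials(1)[OF smooth_dir_deriv[OF c], of "(0, 1)" "snd p" "fst p"]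
    by (metis prod.collapse vector_derivative_at)
  have "dir_deriv (0, 1) f x = dir_deriv (0, 1) c x + antideriv (dir_deriv (0, 1) (dir_deriv (1, 0) f)) x" for x
    using dir_deriv_diff[OF f P, of "(0, 1)" x] dir_deriv_antideriv(2)[OF smooth_dir_deriv[OF f]]
    by (simp add: c_def P_def)
  then have "dir_deriv (0, 1) f
    = (\<lambda>x. dir_deriv (0, 1) c x + antideriv (dir_deriv (0, 1) (dir_deriv (1, 0) f)) x)"
    by (rule ext)
  then have "dir_deriv (1, 0) (dir_deriv (0, 1) f) p
    = dir_deriv (1, 0) (\<lambda>x. dir_deriv (0, 1) c x + antideriv (dir_deriv (0, 1) (dir_deriv (1, 0) f)) x) p"
    by (rule arg_cong)
  also have "\<dots> = dir_deriv (1, 0) (dir_deriv (0, 1) c) p +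
    dir_deriv (1, 0) (antideriv (dir_deriv (0, 1) (dir_deriv (1, 0) f))) p"
    by (intro dir_deriv_eq has_derivative_add smooth_has_derivative smooth_dir_deriv smooth_antideriv c f)
  finally show ?thesis
    by (simp add: z dir_deriv_antideriv smooth_dir_deriv f)
qed

text \<open>Integration in \<open>t\<^sub>2\<close> is done first, by exchanging the coordinates
  around \<open>antideriv\<close>, and integration in \<open>t\<^sub>1\<close> second. In
  \<open>double_antiderivative\<close> the inner derivative is the one in \<open>t\<^sub>1\<close>,
  so each derivative undoes one integral directly.\<close>

lemma exists_double_antiderivative:
  assumes "smooth (\<lambda>(t\<^sub>1, t\<^sub>2). h t\<^sub>1 t\<^sub>2)"
  shows "\<exists>\<Phi>. double_antiderivative h \<Phi>"
proof -
  let ?h = "\<lambda>p. h (fst p) (snd p)"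
  have h: "smooth ?h" using assms by (simp add: split_beta')
  define G where "G = (\<lambda>p. antideriv (\<lambda>p. ?h (snd p, fst p)) (snd p, fst p))"
  have sw: "smooth (\<lambda>p. ?h (snd p, fst p))"
    by (rule smooth_compose[OF h]) (intro smooth_intros)
  have G: "smooth G"
    unfolding G_def by (rule smooth_compose[OF smooth_antideriv[OF sw]]) (intro smooth_intros)
  have dG: "((\<lambda>s. G (x, s)) has_vector_derivative h x y) (at y)" for x y
    using smooth_has_partials(1)[OF smooth_antideriv[OF sw], of x y]
    unfolding dir_deriv_antideriv(1)[OF sw] by (simp add: G_def)
  have A: "smooth (antideriv G)" by (intro smooth_antideriv G)
  have "((\<lambda>s. antideriv G (s, y)) has_vector_derivative G (x, y)) (at x)" for x y
    using smooth_has_partials(1)[OF A] by (simp add: dir_deriv_antideriv(1)[OF G])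
  then have "pd (\<lambda>s. antideriv G (s, y)) x = G (x, y)" for x y
    by (rule vector_derivative_at)
  moreover have "pd (\<lambda>s. G (x, s)) y = h x y" for x y
    by (rule vector_derivative_at[OF dG])
  ultimately have "double_antiderivative h (\<lambda>x y. antideriv G (x, y))"
    using A by (simp add: double_antiderivative_def split_beta')
  then show ?thesis by blast
qed

section \<open>Products of vectors and matrices\<close>

lemma row_col_add: "row_col (x + y) z = row_col x z + row_col y z"
  "row_col x (y + z) = row_col x y + row_col x z"
  by (simp_all add: row_col_def algebra_simps sum.distrib)

lemma row_col_diff: "row_col (x - y) z = row_col x z - row_col y z"
  "row_col x (y - z) = row_col x y - row_col x z"
  by (simp_all add: row_col_def algebra_simps sum_subtractf)

lemma row_col_minus: "row_col (- x) z = - row_col x z" "row_col x (- z) = - row_col x z"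
  by (simp_all add: row_col_def sum_negf)

lemma row_col_scale: "row_col (c *s x) z = c * row_col x z"
  "row_col x (c *s z) = c * row_col x z"
  by (simp_all add: row_col_def algebra_simps sum_distrib_left)

lemma col_row_scale: "col_row (c *s x) z = smat c (col_row x z)"
  "col_row x (c *s z) = smat c (col_row x z)"
  by (simp_all add: col_row_def smat_def vec_eq_iff)

lemma smat_smat: "smat c (smat d A) = smat (c * d) A"
  by (simp add: smat_def vec_eq_iff)

lemma smat_one: "smat 1 A = A"
  by (simp add: smat_def vec_eq_iff)

lemma smat_add: "smat c (A + B) = smat c A + smat c B" "smat (c + d) A = smat c A + smat d A"
  by (simp_all add: smat_def vec_eq_iff algebra_simps)

lemma smat_mat: "smat c (mat d) = mat (c * d)"
  by (simp add: smat_def vec_eq_iff mat_def)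

lemma vector_matrix_smat: "x v* smat c A = c *s (x v* A)" for A :: "complex^'m::finite^'m"
  by (simp add: vec_eq_iff vector_matrix_mult_def smat_def sum_distrib_left algebra_simps)

lemma vector_matrix_mat: "x v* mat c = c *s x" for x :: "complex^'m::finite"
  by (simp add: vec_eq_iff vector_matrix_mult_def mat_def if_distrib if_distribR cong: if_cong)

lemma vector_matrix_col_row: "x v* col_row b a = row_col x b *s a" for x :: "complex^'m::finite"
  by (simp add: vec_eq_iff vector_matrix_mult_def col_row_def row_col_def sum_distrib_left
      sum_distrib_right algebra_simps)

lemma matrix_vector_smat: "smat c A *v x = c *s (A *v x)" for A :: "complex^'m::finite^'m"
  by (simp add: vec_eq_iff matrix_vector_mult_def smat_def sum_distrib_left algebra_simps)

lemma matrix_vector_mat: "mat c *v x = c *s x" for x :: "complex^'m::finite"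
  by (simp add: vec_eq_iff matrix_vector_mult_def mat_def if_distrib if_distribR cong: if_cong)

section \<open>Differentiation of products of vectors and matrices\<close>

lemma bounded_bilinear_row_col: "bounded_bilinear (row_col :: complex^'m::finite \<Rightarrow> _)"
  unfolding bilinear_conv_bounded_bilinear[symmetric] bilinear_def linear_iff
  by (auto simp: row_col_def algebra_simps sum.distrib scaleR_sum_right)

lemma bounded_bilinear_col_row: "bounded_bilinear (col_row :: complex^'m::finite \<Rightarrow> _)"
  unfolding bilinear_conv_bounded_bilinear[symmetric] bilinear_def linear_iff
  by (auto simp: col_row_def vec_eq_iff algebra_simps)

lemma bounded_bilinear_smat: "bounded_bilinear (smat :: complex \<Rightarrow> complex^'m::finite^'m \<Rightarrow> _)"
  unfolding bilinear_conv_bounded_bilinear[symmetric] bilinear_def linear_iff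
  by (auto simp: smat_def vec_eq_iff algebra_simps)

lemma bounded_bilinear_vector_smult: "bounded_bilinear ((*s) :: complex \<Rightarrow> complex^'m::finite \<Rightarrow> _)"
  unfolding bilinear_conv_bounded_bilinear[symmetric] bilinear_def linear_iff
  by (auto simp: vec_eq_iff algebra_simps)

lemma bounded_bilinear_vector_matrix: "bounded_bilinear ((v*) :: complex^'m::finite \<Rightarrow> complex^'m^'m \<Rightarrow> _)"
  unfolding bilinear_conv_bounded_bilinear[symmetric] bilinear_def linear_iff
  by (auto simp: vec_eq_iff vector_matrix_mult_def algebra_simps sum.distrib scaleR_sum_right)

lemma bounded_bilinear_matrix_vector: "bounded_bilinear ((*v) :: complex^'m::finite^'m \<Rightarrow> complex^'m \<Rightarrow> _)"
  unfolding bilinear_conv_bounded_bilinear[symmetric] bilinear_def linear_iff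
  by (auto simp: vec_eq_iff matrix_vector_mult_def algebra_simps sum.distrib scaleR_sum_right)

lemma bounded_linear_mat: "bounded_linear (mat :: complex \<Rightarrow> complex^'m::finite^'m)"
  unfolding linear_conv_bounded_linear[symmetric] linear_iff
  by (auto simp: vec_eq_iff mat_def)

lemmas smooth_vector_intros = smooth_intros
  smooth_bilinear[OF bounded_bilinear_row_col] smooth_bilinear[OF bounded_bilinear_col_row]
  smooth_bilinear[OF bounded_bilinear_smat] smooth_bilinear[OF bounded_bilinear_vector_smult]
  smooth_bilinear[OF bounded_bilinear_vector_matrix] smooth_bilinear[OF bounded_bilinear_matrix_vector]
  smooth_linear[OF bounded_linear_mat] smooth_pd

lemma has_vector_derivative_exp:
  fixes f :: "real \<Rightarrow> complex"
  shows "(f has_vector_derivative d) (at x) \<Longrightarrow> ((\<lambda>x. exp (f x)) has_vector_derivative d * exp (f x)) (at x)"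
  using field_vector_diff_chain_at[OF _ DERIV_exp, of f d x] by (simp add: o_def)

text \<open>Applied repeatedly, these rules follow the structure of an expression and build its
  derivative; after \<open>has_vector_derivative_eq_rhs\<close>, what remains is an algebraic
  comparison with the wanted form.\<close>

lemmas vector_derivative_rules =
  has_vector_derivative_const has_vector_derivative_add has_vector_derivative_diff
  has_vector_derivative_minus has_vector_derivative_mult has_vector_derivative_exp
  bounded_bilinear.has_vector_derivative[OF bounded_bilinear_row_col]
  bounded_bilinear.has_vector_derivative[OF bounded_bilinear_col_row]
  bounded_bilinear.has_vector_derivative[OF bounded_bilinear_smat]
  bounded_bilinear.has_vector_derivative[OF bounded_bilinear_vector_smult]
  bounded_bilinear.has_vector_derivative[OF bounded_bilinear_vector_matrix]
  bounded_bilinear.has_vector_derivative[OF bounded_bilinear_matrix_vector]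
  bounded_linear.has_vector_derivative[OF bounded_linear_mat]

section \<open>Phase changes\<close>

text \<open>A phase change frozen at one time: its four scalars are independent parameters, so the
  algebra of the equations is settled before any time dependence is inserted. With
  \<open>e * f = 1\<close>, every product of one \<open>q\<close> with one \<open>r\<close> is
  unchanged.\<close>

definition gauge_transform :: "complex \<Rightarrow> complex \<Rightarrow> complex \<Rightarrow> complex \<Rightarrow> 'm::finite fields \<Rightarrow> 'm fields" where
  "gauge_transform e f a b s = \<lparr> q = \<lambda>n y. e *s q s n y, r = \<lambda>n y. f *s r s n y, logu = logu s,
     v = \<lambda>n y. v s n y + mat a, w = \<lambda>n y. w s n y + b \<rparr>"

text \<open>The time derivative of \<open>gauge_transform e f a b s\<close> when \<open>s\<close>, \<open>e\<close>, \<open>f\<close>, \<open>a\<close>, \<open>b\<close> have derivatives \<open>d\<close>,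
  \<open>c e\<close>, \<open>- c f\<close>, \<open>a'\<close>, \<open>b'\<close>.\<close>

definition gauge_transform_deriv ::
  "complex \<Rightarrow> complex \<Rightarrow> complex \<Rightarrow> complex \<Rightarrow> complex \<Rightarrow> 'm::finite fields \<Rightarrow> 'm fields \<Rightarrow> 'm fields" where
  "gauge_transform_deriv e f c a' b' s d = \<lparr> q = \<lambda>n y. e *s (q d n y + c *s q s n y),
     r = \<lambda>n y. f *s (r d n y - c *s r s n y), logu = logu d,
     v = \<lambda>n y. v d n y + mat a', w = \<lambda>n y. w d n y + b' \<rparr>"

lemma pd_smult: "smooth f \<Longrightarrow> pd (\<lambda>z. e *s f z) y = e *s pd f y"
  for f :: "real \<Rightarrow> complex^'m::finite"
  by (intro pd_eq bounded_linear.has_vector_derivative[OF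
        bounded_bilinear.bounded_linear_right[OF bounded_bilinear_vector_smult]] smooth_has_pd)

lemma pd_add_const: "smooth f \<Longrightarrow> pd (\<lambda>z. f z + c) y = pd f y"
  by (rule pd_eq) (auto intro!: derivative_eq_intros smooth_has_pd)

lemma u_gauge [simp]: "u (gauge_transform e f a b s) = u s" "upow (gauge_transform e f a b s) = upow s"
  by (auto simp: u_def upow_def gauge_transform_def fun_eq_iff)

lemma gauge_products:
  assumes "e * f = 1"
  shows "row_col (e *s x) (f *s z) = row_col x z" "col_row (f *s z) (e *s x) = col_row z x"
  using assms by (simp_all add: row_col_scale col_row_scale smat_smat smat_one mult.commute
      mult.assoc[symmetric])

text \<open>The shifts \<open>a\<close> and \<open>b\<close> depend on neither \<open>n\<close> nor
  \<open>y\<close>, so they drop out of the difference of \<open>v\<close> and of the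
  \<open>y\<close>-derivative of \<open>w\<close>.\<close>

lemma constraints_gauge:
  assumes "smooth_fields s" "e * f = 1" "constraints \<alpha> \<beta> \<gamma> \<delta> s"
  shows "constraints \<alpha> \<beta> \<gamma> \<delta> (gauge_transform e f a b s)"
proof -
  have "smooth (w s n)" for n using assms(1) by (simp add: smooth_fields_def)
  with assms(3) show ?thesis
    unfolding constraints_def u_gauge
    by (simp add: gauge_transform_def gauge_products[OF assms(2)] pd_add_const)
qed

text \<open>A phase with rate \<open>c\<close> adds \<open>\<i> * c\<close> times \<open>q\<close>
  to the first equation, which raising \<open>w\<close> by \<open>b = \<i> * c\<close> compensates;
  in the equation for \<open>r\<close> both contributions change sign. The shift of \<open>v\<close>
  is felt only through its own time derivative, hence the new constant.\<close>

lemma t1_flow_gauge: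
  fixes s d :: "'m::finite fields"
  assumes ef: "e * f = 1" and flow: "t1_flow \<alpha> \<beta> \<gamma> \<delta> F s d" and b: "b = \<i> * c"
  shows "t1_flow \<alpha> \<beta> \<gamma> \<delta> (\<lambda>y. F y + mat (\<i> * a')) (gauge_transform e f a b s) (gauge_transform_deriv e f c a' b' s d)"
  unfolding t1_flow_def u_gauge
proof (intro allI conjI)
  fix n y
  let ?s = "gauge_transform e f a b s" and ?d = "gauge_transform_deriv e f c a' b' s d"
  have q0: "\<i> *s q d n y - (\<alpha> * upow s \<gamma> n y) *s q s (n-1) y
       - (\<beta> * upow s \<delta> (n+1) y) *s q s (n+1) y - w s n y *s q s n y = 0"
    and r0: "\<i> *s r d n y + (\<beta> * upow s \<delta> n y) *s r s (n-1) y
       + (\<alpha> * upow s \<gamma> (n+1) y) *s r s (n+1) y + w s n y *s r s n y = 0"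
    and v0: "smat \<i> (v d n y) =
       smat 2 (pd (\<lambda>z. smat (\<alpha> * upow s \<gamma> n z) (col_row (r s n z) (q s (n-1) z))
                     - smat (\<beta> * upow s \<delta> n z) (col_row (r s (n-1) z) (q s n z))) y) + F y"
    using flow unfolding t1_flow_def by blast+
  have Q: "\<i> *s (e *s (qd + c *s q0)) - A *s (e *s qm) - B *s (e *s qp) - (w0 + b) *s (e *s q0)
     = e *s (\<i> *s qd - A *s qm - B *s qp - w0 *s q0)" for qd q0 qm qp :: "complex^'m" and A B w0
    using b by (simp add: vec_eq_iff algebra_simps)
  show "\<i> *s q ?d n y - (\<alpha> * upow s \<gamma> n y) *s q ?s (n-1) y
       - (\<beta> * upow s \<delta> (n+1) y) *s q ?s (n+1) y - w ?s n y *s q ?s n y = 0"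
    unfolding gauge_transform_def gauge_transform_deriv_def fields.select_convs Q q0 by simp
  have R: "\<i> *s (f *s (rd - c *s r0)) + B *s (f *s rm) + A *s (f *s rp) + (w0 + b) *s (f *s r0)
     = f *s (\<i> *s rd + B *s rm + A *s rp + w0 *s r0)" for rd r0 rm rp :: "complex^'m" and A B w0
    using b by (simp add: vec_eq_iff algebra_simps)
  show "\<i> *s r ?d n y + (\<beta> * upow s \<delta> n y) *s r ?s (n-1) y
       + (\<alpha> * upow s \<gamma> (n+1) y) *s r ?s (n+1) y + w ?s n y *s r ?s n y = 0"
    unfolding gauge_transform_def gauge_transform_deriv_def fields.select_convs R r0 by simp
  show "smat \<i> (v ?d n y) =
       smat 2 (pd (\<lambda>z. smat (\<alpha> * upow s \<gamma> n z) (col_row (r ?s n z) (q ?s (n-1) z))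
                     - smat (\<beta> * upow s \<delta> n z) (col_row (r ?s (n-1) z) (q ?s n z))) y)
       + (F y + mat (\<i> * a'))"
    by (simp add: gauge_transform_def gauge_transform_deriv_def gauge_products[OF ef] smat_add smat_mat v0)
qed

text \<open>The phase contributes \<open>k * c\<close>, and the shift of \<open>v\<close>
  contributes \<open>(\<gamma> + \<delta>) * a\<close> because it is the same at \<open>n\<close>
  and \<open>n+1\<close>; these two must cancel. The shift of \<open>w\<close> enters only through
  its time derivative, which moves \<open>H\<close> by \<open>k * b'\<close>.\<close>

lemma t2_flow_gauge:
  fixes s d :: "'m::finite fields"
  assumes s: "smooth_fields s" and ef: "e * f = 1" and flow: "t2_flow \<alpha> \<beta> \<gamma> \<delta> k H s d"
    and a: "k * c + (\<gamma> + \<delta>) * a = 0"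
  shows "t2_flow \<alpha> \<beta> \<gamma> \<delta> k (\<lambda>n. H n + k * b') (gauge_transform e f a b s) (gauge_transform_deriv e f c a' b' s d)"
proof -
  let ?s = "gauge_transform e f a b s" and ?d = "gauge_transform_deriv e f c a' b' s d"
  have sm: "smooth (q s n)" "smooth (r s n)" for n using s by (simp_all add: smooth_fields_def)
  have pds: "pd (\<lambda>z. e *s q s n z) y = e *s pd (q s n) y"
    "pd (\<lambda>z. f *s r s n z) y = f *s pd (r s n) y" for n y
    by (intro pd_smult sm)+
  have pdss: "pd (pd (q ?s n)) y = e *s pd (pd (q s n)) y" "pd (pd (r ?s n)) y = f *s pd (pd (r s n)) y" for n y
    by (simp_all add: gauge_transform_def pds pd_smult smooth_pd sm)
  have prods: "qr ?s l m y = qr s l m y" "row_col (pd (q ?s l) y) (r ?s m y) = row_col (pd (q s l) y) (r s m y)"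
    "row_col (q ?s l y) (pd (r ?s m) y) = row_col (q s l y) (pd (r s m) y)" for l m y
    by (simp_all add: gauge_transform_def pds gauge_products[OF ef])
  \<comment> \<open>The assumed cancellation, multiplied by a phase factor \<open>z\<close> and a
    component \<open>x\<close>, with the factors ordered as the expansion of \<open>Q\<close> and
    \<open>R\<close> leaves them.\<close>
  have kc: "c * (z * (k * x)) = - (\<gamma> * (a * (z * x))) - \<delta> * (a * (z * x))" for x z
    using a by algebra
  have Q: "k *s (e *s (qd + c *s q0)) + e *s qyy + (e *s q0) v* (smat \<gamma> (v0 + mat a) + smat \<delta> (v1 + mat a)) + g *s (e *s q0)
     = e *s (k *s qd + qyy + q0 v* (smat \<gamma> v0 + smat \<delta> v1) + g *s q0)"
    for qd q0 qyy :: "complex^'m" and v0 v1 :: "complex^'m^'m" and g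
    by (simp add: vec_eq_iff algebra_simps scalar_vector_matrix_assoc vector_matrix_mult_add_rdistrib vector_matrix_smat
        vector_matrix_mat kc)
  have R: "k *s (f *s (rd - c *s r0)) - f *s ryy - (smat \<delta> (v0 + mat a) + smat \<gamma> (v1 + mat a)) *v (f *s r0) - g *s (f *s r0)
     = f *s (k *s rd - ryy - (smat \<delta> v0 + smat \<gamma> v1) *v r0 - g *s r0)"
    for rd r0 ryy :: "complex^'m" and v0 v1 :: "complex^'m^'m" and g
    by (simp add: vec_eq_iff algebra_simps vector_scalar_commute matrix_vector_mult_add_rdistrib matrix_vector_smat
        matrix_vector_mat kc)
  show ?thesis
    unfolding t2_flow_def u_gauge prods pdss
  proof (intro allI conjI, goal_cases)
    case (1 n y)
    show ?case unfolding gauge_transform_def gauge_transform_deriv_def fields.select_convs Q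
      using flow unfolding t2_flow_def by simp
  next
    case (2 n y)
    show ?case unfolding gauge_transform_def gauge_transform_deriv_def fields.select_convs R
      using flow unfolding t2_flow_def by simp
  next
    case (3 n y)
    show ?case unfolding gauge_transform_def gauge_transform_deriv_def fields.select_convs
      using flow unfolding t2_flow_def by blast
  next
    case (4 n y)
    show ?case unfolding gauge_transform_def gauge_transform_deriv_def fields.select_convs distrib_left[of k]
      using flow unfolding t2_flow_def by (simp only: add.assoc[symmetric])
  qed
qed

section \<open>Phases that vary with the two times\<close>

lemma smooth_time_slices:
  fixes f :: "real \<Rightarrow> real \<Rightarrow> real \<Rightarrow> 'a::real_normed_vector"
  assumes "smooth (\<lambda>(y, t\<^sub>1, t\<^sub>2). f y t\<^sub>1 t\<^sub>2)"
  shows "smooth (\<lambda>y. f y t\<^sub>1 t\<^sub>2)" "smooth (\<lambda>t. f y t t\<^sub>2)" "smooth (\<lambda>t. f y t\<^sub>1 t)"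
proof -
  have "smooth (\<lambda>y. (\<lambda>(y, t\<^sub>1, t\<^sub>2). f y t\<^sub>1 t\<^sub>2) (y, t\<^sub>1, t\<^sub>2))"
    "smooth (\<lambda>t. (\<lambda>(y, t\<^sub>1, t\<^sub>2). f y t\<^sub>1 t\<^sub>2) (y, t, t\<^sub>2))"
    "smooth (\<lambda>t. (\<lambda>(y, t\<^sub>1, t\<^sub>2). f y t\<^sub>1 t\<^sub>2) (y, t\<^sub>1, t))"
    by (rule smooth_compose[OF assms]; intro smooth_intros)+
  then show "smooth (\<lambda>y. f y t\<^sub>1 t\<^sub>2)" "smooth (\<lambda>t. f y t t\<^sub>2)" "smooth (\<lambda>t. f y t\<^sub>1 t)"
    by simp_all
qed

lemma smooth_time_only:
  fixes f :: "real \<Rightarrow> real \<Rightarrow> 'a::real_normed_vector"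
  assumes "smooth (\<lambda>(t\<^sub>1, t\<^sub>2). f t\<^sub>1 t\<^sub>2)"
  shows "smooth (\<lambda>(y::real, t\<^sub>1, t\<^sub>2). f t\<^sub>1 t\<^sub>2)"
  using smooth_compose[OF assms smooth_snd[OF smooth_id]]
  by (simp add: split_beta')

lemma phase_change_eq_gauge:
  "phase_change k \<Phi> a b S t\<^sub>1 t\<^sub>2 = gauge_transform (exp (- (\<i> / k * \<Phi> t\<^sub>1 t\<^sub>2))) (exp (\<i> / k * \<Phi> t\<^sub>1 t\<^sub>2)) (a t\<^sub>1 t\<^sub>2) (b t\<^sub>1 t\<^sub>2) (S t\<^sub>1 t\<^sub>2)"
  by (simp add: phase_change_def gauge_transform_def)

text \<open>The product rule for \<open>exp (- \<phi> t)\<close> times \<open>q\<close> identifies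
  the rate \<open>c\<close> of \<open>gauge_transform_deriv\<close> as \<open>- \<phi>'\<close>; the
  reciprocal factor on \<open>r\<close> gives the opposite rate.\<close>

lemma fields_pd_gauge:
  assumes S: "\<And>n y. smooth (\<lambda>t. q (S t) n y)" "\<And>n y. smooth (\<lambda>t. r (S t) n y)"
      "\<And>n y. smooth (\<lambda>t. v (S t) n y)" "\<And>n y. smooth (\<lambda>t. w (S t) n y)"
    and \<phi>: "(\<phi> has_vector_derivative \<phi>') (at t)" and a: "(a has_vector_derivative a') (at t)"
    and b: "(b has_vector_derivative b') (at t)"
  shows "fields_pd (\<lambda>t. gauge_transform (exp (- \<phi> t)) (exp (\<phi> t)) (a t) (b t) (S t)) t
    = gauge_transform_deriv (exp (- \<phi> t)) (exp (\<phi> t)) (- \<phi>') a' b' (S t) (fields_pd S t)"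
proof -
  note rules = vector_derivative_rules S[THEN smooth_has_pd] \<phi> a b
  have dq: "((\<lambda>t. exp (- \<phi> t) *s q (S t) n y) has_vector_derivative
      exp (- \<phi> t) *s (pd (\<lambda>\<tau>. q (S \<tau>) n y) t + (- \<phi>') *s q (S t) n y)) (at t)" for n y
    by (rule has_vector_derivative_eq_rhs, (rule rules)+) (simp add: vec_eq_iff algebra_simps)
  have dr: "((\<lambda>t. exp (\<phi> t) *s r (S t) n y) has_vector_derivative
      exp (\<phi> t) *s (pd (\<lambda>\<tau>. r (S \<tau>) n y) t - (- \<phi>') *s r (S t) n y)) (at t)" for n y
    by (rule has_vector_derivative_eq_rhs, (rule rules)+) (simp add: vec_eq_iff algebra_simps)
  have dv: "((\<lambda>t. v (S t) n y + mat (a t)) has_vector_derivative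
      pd (\<lambda>\<tau>. v (S \<tau>) n y) t + mat a') (at t)" for n y
    by (rule rules)+
  have dw: "((\<lambda>t. w (S t) n y + b t) has_vector_derivative pd (\<lambda>\<tau>. w (S \<tau>) n y) t + b') (at t)" for n y
    by (rule rules)+
  show ?thesis
    by (simp only: fields_pd_def gauge_transform_def gauge_transform_deriv_def fields.select_convs
        dq[THEN pd_eq] dr[THEN pd_eq] dv[THEN pd_eq] dw[THEN pd_eq])
qed

text \<open>The phase of \<open>q\<close> has rates \<open>- \<i> / k\<close> times the partial
  derivatives of \<Phi>. The condition \<open>b = \<i> * c\<close> of the first flow then yields
  \<open>b\<close>, and \<open>k * c + (\<gamma> + \<delta>) * a = 0\<close> of the second yields
  \<open>a\<close>. The constants change by \<open>\<i>\<close> times the derivative of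
  \<open>a\<close> in the first time and \<open>k\<close> times that of \<open>b\<close> in the
  second. \<open>F\<close> and \<open>H\<close> are left general, so that the inverse phase change
  is covered too.\<close>

lemma solution_phase_change:
  fixes \<Phi> :: "real \<Rightarrow> real \<Rightarrow> complex" and S :: "real \<Rightarrow> real \<Rightarrow> 'm::finite fields"
  assumes gd: "\<gamma> + \<delta> \<noteq> 0" and k: "k \<noteq> 0" and \<Phi>: "smooth (\<lambda>(t\<^sub>1, t\<^sub>2). \<Phi> t\<^sub>1 t\<^sub>2)"
    and h: "\<And>t\<^sub>1 t\<^sub>2. h t\<^sub>1 t\<^sub>2 = pd (\<lambda>\<tau>. pd (\<lambda>\<sigma>. \<Phi> \<sigma> \<tau>) t\<^sub>1) t\<^sub>2"
    and a: "\<And>t\<^sub>1 t\<^sub>2. a t\<^sub>1 t\<^sub>2 = \<i> / (\<gamma> + \<delta>) * pd (\<lambda>\<tau>. \<Phi> t\<^sub>1 \<tau>) t\<^sub>2"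
    and b: "\<And>t\<^sub>1 t\<^sub>2. b t\<^sub>1 t\<^sub>2 = 1 / k * pd (\<lambda>\<sigma>. \<Phi> \<sigma> t\<^sub>2) t\<^sub>1"
    and sol: "solution \<alpha> \<beta> \<gamma> \<delta> k F H S"
  shows "solution \<alpha> \<beta> \<gamma> \<delta> k (\<lambda>y t\<^sub>1 t\<^sub>2. F y t\<^sub>1 t\<^sub>2 - mat (h t\<^sub>1 t\<^sub>2 / (\<gamma> + \<delta>)))
    (\<lambda>n t\<^sub>1 t\<^sub>2. H n t\<^sub>1 t\<^sub>2 + h t\<^sub>1 t\<^sub>2) (phase_change k \<Phi> a b S)"
proof -
  define P where "P = (\<lambda>(t\<^sub>1, t\<^sub>2). \<Phi> t\<^sub>1 t\<^sub>2)"
  have P: "smooth P" using \<Phi> by (simp add: P_def)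
  have S: "smooth (\<lambda>(y, t\<^sub>1, t\<^sub>2). q (S t\<^sub>1 t\<^sub>2) n y)" "smooth (\<lambda>(y, t\<^sub>1, t\<^sub>2). r (S t\<^sub>1 t\<^sub>2) n y)"
    "smooth (\<lambda>(y, t\<^sub>1, t\<^sub>2). logu (S t\<^sub>1 t\<^sub>2) n y)" "smooth (\<lambda>(y, t\<^sub>1, t\<^sub>2). v (S t\<^sub>1 t\<^sub>2) n y)"
    "smooth (\<lambda>(y, t\<^sub>1, t\<^sub>2). w (S t\<^sub>1 t\<^sub>2) n y)" for n
    using sol unfolding solution_def by blast+
  have d1: "((\<lambda>\<sigma>. \<Phi> \<sigma> t\<^sub>2) has_vector_derivative dir_deriv (1, 0) P (t\<^sub>1, t\<^sub>2)) (at t\<^sub>1)"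
    and d2: "((\<lambda>\<tau>. \<Phi> t\<^sub>1 \<tau>) has_vector_derivative dir_deriv (0, 1) P (t\<^sub>1, t\<^sub>2)) (at t\<^sub>2)" for t\<^sub>1 t\<^sub>2
    using smooth_has_partials[OF P] by (simp_all add: P_def)
  have a': "a t\<^sub>1 t\<^sub>2 = \<i> / (\<gamma> + \<delta>) * dir_deriv (0, 1) P (t\<^sub>1, t\<^sub>2)"
    and b': "b t\<^sub>1 t\<^sub>2 = 1 / k * dir_deriv (1, 0) P (t\<^sub>1, t\<^sub>2)" for t\<^sub>1 t\<^sub>2
    by (simp_all add: a b pd_eq[OF d1] pd_eq[OF d2])
  have h': "h t\<^sub>1 t\<^sub>2 = dir_deriv (0, 1) (dir_deriv (1, 0) P) (t\<^sub>1, t\<^sub>2)" for t\<^sub>1 t\<^sub>2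
    unfolding h pd_eq[OF d1] by (rule pd_eq[OF smooth_has_partials(2)[OF smooth_dir_deriv[OF P]]])
  have smab: "smooth (\<lambda>(t\<^sub>1, t\<^sub>2). a t\<^sub>1 t\<^sub>2)" "smooth (\<lambda>(t\<^sub>1, t\<^sub>2). b t\<^sub>1 t\<^sub>2)"
    using smooth_mult[OF smooth_const[of "\<i> / (\<gamma> + \<delta>)"] smooth_dir_deriv[OF P, of "(0, 1)"]]
      smooth_mult[OF smooth_const[of "1 / k"] smooth_dir_deriv[OF P, of "(1, 0)"]]
    by (simp_all add: a' b' split_beta')
  note sm = S smooth_time_only[OF \<Phi>] smab[THEN smooth_time_only]
  have "smooth (\<lambda>(y, t\<^sub>1, t\<^sub>2). q (phase_change k \<Phi> a b S t\<^sub>1 t\<^sub>2) n y) \<and>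
      smooth (\<lambda>(y, t\<^sub>1, t\<^sub>2). r (phase_change k \<Phi> a b S t\<^sub>1 t\<^sub>2) n y) \<and>
      smooth (\<lambda>(y, t\<^sub>1, t\<^sub>2). logu (phase_change k \<Phi> a b S t\<^sub>1 t\<^sub>2) n y) \<and>
      smooth (\<lambda>(y, t\<^sub>1, t\<^sub>2). v (phase_change k \<Phi> a b S t\<^sub>1 t\<^sub>2) n y) \<and>
      smooth (\<lambda>(y, t\<^sub>1, t\<^sub>2). w (phase_change k \<Phi> a b S t\<^sub>1 t\<^sub>2) n y)" for n
    using sm unfolding phase_change_def fields.select_convs split_beta'
    by (intro conjI smooth_vector_intros)
  moreover have "constraints \<alpha> \<beta> \<gamma> \<delta> (phase_change k \<Phi> a b S t\<^sub>1 t\<^sub>2) \<and>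
    t1_flow \<alpha> \<beta> \<gamma> \<delta> (\<lambda>y. F y t\<^sub>1 t\<^sub>2 - mat (h t\<^sub>1 t\<^sub>2 / (\<gamma> + \<delta>))) (phase_change k \<Phi> a b S t\<^sub>1 t\<^sub>2)
      (fields_pd (\<lambda>\<tau>. phase_change k \<Phi> a b S \<tau> t\<^sub>2) t\<^sub>1) \<and>
    t2_flow \<alpha> \<beta> \<gamma> \<delta> k (\<lambda>n. H n t\<^sub>1 t\<^sub>2 + h t\<^sub>1 t\<^sub>2) (phase_change k \<Phi> a b S t\<^sub>1 t\<^sub>2)
      (fields_pd (\<lambda>\<tau>. phase_change k \<Phi> a b S t\<^sub>1 \<tau>) t\<^sub>2)" for t\<^sub>1 t\<^sub>2
  proof -
    have s: "smooth_fields (S t\<^sub>1 t\<^sub>2)"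
      using S[THEN smooth_time_slices(1)] by (simp add: smooth_fields_def)
    have c: "constraints \<alpha> \<beta> \<gamma> \<delta> (S t\<^sub>1 t\<^sub>2)"
      and f1: "t1_flow \<alpha> \<beta> \<gamma> \<delta> (\<lambda>y. F y t\<^sub>1 t\<^sub>2) (S t\<^sub>1 t\<^sub>2) (fields_pd (\<lambda>\<tau>. S \<tau> t\<^sub>2) t\<^sub>1)"
      and f2: "t2_flow \<alpha> \<beta> \<gamma> \<delta> k (\<lambda>n. H n t\<^sub>1 t\<^sub>2) (S t\<^sub>1 t\<^sub>2) (fields_pd (\<lambda>\<tau>. S t\<^sub>1 \<tau>) t\<^sub>2)"
      using sol unfolding solution_def by blast+
    have ef: "exp (- x) * exp x = 1" for x :: complex
      by (simp add: exp_minus)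
    let ?p1 = "dir_deriv (1, 0) P (t\<^sub>1, t\<^sub>2)" and ?p2 = "dir_deriv (0, 1) P (t\<^sub>1, t\<^sub>2)" and ?h = "h t\<^sub>1 t\<^sub>2"
    note slices = smooth_has_partials[OF smooth_dir_deriv[OF P]]
    \<comment> \<open>Here the mixed partial derivatives are exchanged: \<open>a\<close> contains
      the derivative of \<Phi> in the second time and is now differentiated in the first, while
      \<open>h\<close> is formed in the opposite order.\<close>
    have e1: "fields_pd (\<lambda>\<tau>. phase_change k \<Phi> a b S \<tau> t\<^sub>2) t\<^sub>1 =
      gauge_transform_deriv (exp (- (\<i> / k * \<Phi> t\<^sub>1 t\<^sub>2))) (exp (\<i> / k * \<Phi> t\<^sub>1 t\<^sub>2)) (- (\<i> / k * ?p1)) (\<i> / (\<gamma> + \<delta>) * ?h)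
       (1 / k * dir_deriv (1, 0) (dir_deriv (1, 0) P) (t\<^sub>1, t\<^sub>2)) (S t\<^sub>1 t\<^sub>2) (fields_pd (\<lambda>\<tau>. S \<tau> t\<^sub>2) t\<^sub>1)"
      unfolding phase_change_eq_gauge a' b' h' mixed_partials[OF P, symmetric]
      by (rule fields_pd_gauge) (intro S[THEN smooth_time_slices(2)] d1 slices(1)
        has_vector_derivative_mult_right)+
    have e2: "fields_pd (\<lambda>\<tau>. phase_change k \<Phi> a b S t\<^sub>1 \<tau>) t\<^sub>2 =
      gauge_transform_deriv (exp (- (\<i> / k * \<Phi> t\<^sub>1 t\<^sub>2))) (exp (\<i> / k * \<Phi> t\<^sub>1 t\<^sub>2)) (- (\<i> / k * ?p2))
       (\<i> / (\<gamma> + \<delta>) * dir_deriv (0, 1) (dir_deriv (0, 1) P) (t\<^sub>1, t\<^sub>2))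
       (1 / k * ?h) (S t\<^sub>1 t\<^sub>2) (fields_pd (\<lambda>\<tau>. S t\<^sub>1 \<tau>) t\<^sub>2)"
      unfolding phase_change_eq_gauge a' b' h'
      by (rule fields_pd_gauge) (intro S[THEN smooth_time_slices(3)] d2 slices(2)
        has_vector_derivative_mult_right)+
    have m: "mat (\<i> * (\<i> / (\<gamma> + \<delta>) * ?h)) = - (mat (?h / (\<gamma> + \<delta>)) :: complex^'m^'m)"
      by (simp add: mat_def vec_eq_iff)
    have b1: "b t\<^sub>1 t\<^sub>2 = \<i> * - (\<i> / k * ?p1)" and a2: "k * - (\<i> / k * ?p2) + (\<gamma> + \<delta>) * a t\<^sub>1 t\<^sub>2 = 0"
      and kh: "k * (1 / k * ?h) = ?h"
      using k gd by (simp_all add: a' b')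
    show ?thesis
    proof (intro conjI)
      show "constraints \<alpha> \<beta> \<gamma> \<delta> (phase_change k \<Phi> a b S t\<^sub>1 t\<^sub>2)"
        unfolding phase_change_eq_gauge by (rule constraints_gauge[OF s ef c])
      show "t1_flow \<alpha> \<beta> \<gamma> \<delta> (\<lambda>y. F y t\<^sub>1 t\<^sub>2 - mat (h t\<^sub>1 t\<^sub>2 / (\<gamma> + \<delta>))) (phase_change k \<Phi> a b S t\<^sub>1 t\<^sub>2)
        (fields_pd (\<lambda>\<tau>. phase_change k \<Phi> a b S \<tau> t\<^sub>2) t\<^sub>1)"
        unfolding e1 unfolding phase_change_eq_gauge diff_conv_add_uminus m[symmetric]
        by (rule t1_flow_gauge[OF ef f1 b1])
      have "t2_flow \<alpha> \<beta> \<gamma> \<delta> k (\<lambda>n. H n t\<^sub>1 t\<^sub>2 + k * (1 / k * ?h)) (phase_change k \<Phi> a b S t\<^sub>1 t\<^sub>2)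
        (fields_pd (\<lambda>\<tau>. phase_change k \<Phi> a b S t\<^sub>1 \<tau>) t\<^sub>2)"
        unfolding e2 unfolding phase_change_eq_gauge by (rule t2_flow_gauge[OF s ef f2 a2])
      then show "t2_flow \<alpha> \<beta> \<gamma> \<delta> k (\<lambda>n. H n t\<^sub>1 t\<^sub>2 + h t\<^sub>1 t\<^sub>2) (phase_change k \<Phi> a b S t\<^sub>1 t\<^sub>2)
        (fields_pd (\<lambda>\<tau>. phase_change k \<Phi> a b S t\<^sub>1 \<tau>) t\<^sub>2)"
        unfolding kh .
    qed
  qed
  ultimately show ?thesis unfolding solution_def by blast
qed

text \<open>Phase factors are multiplicative and shifts additive, so changing the sign of all three
  data undoes the transformation. This supplies the converse direction for solutions.\<close>

lemma phase_change_inverse: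
  "phase_change k (\<lambda>t\<^sub>1 t\<^sub>2. - \<Phi> t\<^sub>1 t\<^sub>2) (\<lambda>t\<^sub>1 t\<^sub>2. - a t\<^sub>1 t\<^sub>2) (\<lambda>t\<^sub>1 t\<^sub>2. - b t\<^sub>1 t\<^sub>2) (phase_change k \<Phi> a b S) = S"
  by (auto simp: phase_change_def fun_eq_iff vec_eq_iff mat_def exp_minus)

text \<open>One component of the comparison of \<open>q\<^sub>n\<^sub>,\<^sub>t\<^sub>1\<^sub>t\<^sub>2\<close> and \<open>q\<^sub>n\<^sub>,\<^sub>t\<^sub>2\<^sub>t\<^sub>1\<close> as a polynomial identity. The suffixes
  \<open>m\<close>, \<open>0\<close>, \<open>p\<close> stand for the sites \<open>n - 1\<close>, \<open>n\<close>, \<open>n + 1\<close>; \<open>Q\<close>, \<open>P\<close>, \<open>Y\<close> for components of \<open>q\<close>, \<open>q\<^sub>y\<close>,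
  \<open>q\<^sub>y\<^sub>y\<close>; \<open>V\<close> for those of \<open>q v\<^sub>n\<close>; \<open>g\<close>, \<open>x\<close>, \<open>z\<close> for \<open>q r\<close>, \<open>q\<^sub>y r\<close>, \<open>q r\<^sub>y\<close>; \<open>A0\<close>, \<open>A1\<close>, \<open>B0\<close>, \<open>B1\<close> for
  \<open>\<alpha> u\<^sub>n\<^sup>\<gamma>\<close>, \<open>\<alpha> u\<^sub>n\<^sub>+\<^sub>1\<^sup>\<gamma>\<close>, \<open>\<beta> u\<^sub>n\<^sup>\<delta>\<close>, \<open>\<beta> u\<^sub>n\<^sub>+\<^sub>1\<^sup>\<delta>\<close>; \<open>L\<close>, \<open>W\<close>, \<open>E\<close> for the \<open>t\<^sub>2\<close>-derivatives of
  \<open>log u\<close>, \<open>w\<close>, \<open>q\<close>.\<close>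

lemma commutator_identity:
  fixes \<gamma> \<delta> k :: complex
  assumes L0: "k * L0 = (x00 - z00 + (\<gamma> - \<delta>) * g00\<^sup>2) - (xmm - zmm + (\<gamma> - \<delta>) * gmm\<^sup>2)"
    and L1: "k * L1 = (xpp - zpp + (\<gamma> - \<delta>) * gpp\<^sup>2) - (x00 - z00 + (\<gamma> - \<delta>) * g00\<^sup>2)"
    and W: "k * W = \<gamma> * B0 * (- x0m + z0m + \<delta> * (gmm + g00) * g0m) - \<gamma> * B1 * (- xp0 + zp0 + \<delta> * (g00 + gpp) * gp0)
      + \<delta> * A0 * (- xm0 + zm0 - \<gamma> * (gmm + g00) * gm0) - \<delta> * A1 * (- x0p + z0p - \<gamma> * (g00 + gpp) * g0p) + H"
    and Em: "k * Em = - (Ym + \<gamma> * (Vm + 2 * (zmm * Qm + gmm * Pm)) + \<delta> * Vm + \<gamma> * \<delta> * gmm\<^sup>2 * Qm)"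
    and E0: "k * E0 = - (Y0 + \<gamma> * V0 + \<delta> * (V0 - 2 * (z00 * Q0 + g00 * P0)) + \<gamma> * \<delta> * g00\<^sup>2 * Q0)"
    and Ep: "k * Ep = - (Yp + \<gamma> * (Vp - 2 * (zp0 * Q0 + gp0 * P0))
      + \<delta> * (Vp - 2 * (zp0 * Q0 + gp0 * P0) - 2 * (zpp * Qp + gpp * Pp)) + \<gamma> * \<delta> * gpp\<^sup>2 * Qp)"
    and T12: "\<i> * T12 = \<gamma> * L0 * A0 * Qm + A0 * Em + \<delta> * L1 * B1 * Qp + B1 * Ep + W * Q0 + w0 * E0"
    and lm: "lm = gmm - g00" and lp: "lp = g00 - gpp"
    and lm': "lm' = xmm + zmm - (x00 + z00)" and lp': "lp' = x00 + z00 - (xpp + zpp)"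
    and Yd: "\<i> * Yd = (A0 * (\<gamma> * lm)\<^sup>2 + A0 * \<gamma> * lm') * Qm + 2 * A0 * \<gamma> * lm * Pm + A0 * Ym
      + (B1 * (\<delta> * lp)\<^sup>2 + B1 * \<delta> * lp') * Qp + 2 * B1 * \<delta> * lp * Pp + B1 * Yp
      + (\<delta> * (A0 * \<gamma> * lm * gm0 + A0 * (xm0 + zm0) - A1 * \<gamma> * lp * g0p - A1 * (x0p + z0p))
         + \<gamma> * (B0 * \<delta> * lm * g0m + B0 * (x0m + z0m) - B1 * \<delta> * lp * gp0 - B1 * (xp0 + zp0))) * Q0
      + 2 * (\<delta> * (A0 * gm0 - A1 * g0p) + \<gamma> * (B0 * g0m - B1 * gp0)) * P0 + w0 * Y0"
    and VD: "\<i> * VD = A0 * ((\<gamma> + \<delta>) * Vm - 2 * \<delta> * (zm0 * Q0 + gm0 * P0))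
      + B1 * ((\<gamma> + \<delta>) * Vp - 2 * \<delta> * (zp0 * Q0 + gp0 * P0)) + w0 * ((\<gamma> + \<delta>) * V0 - 2 * \<delta> * (z00 * Q0 + g00 * P0))"
    and DV: "\<i> * DV = 2 * \<gamma> * (A0 * \<gamma> * lm * g00 * Qm + A0 * (z00 * Qm + g00 * Pm)
        - B0 * \<delta> * lm * g0m * Q0 - B0 * (z0m * Q0 + g0m * P0))
      + 2 * \<delta> * (A1 * \<gamma> * lp * g0p * Q0 + A1 * (z0p * Q0 + g0p * P0)
        - B1 * \<delta> * lp * g00 * Qp - B1 * (z00 * Qp + g00 * Pp)) + (\<gamma> + \<delta>) * QF"
    and gd: "\<i> * gd = A0 * gm0 + B1 * gp0 - B0 * g0m - A1 * g0p"
    and Qd: "\<i> * Qd = A0 * Qm + B1 * Qp + w0 * Q0"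
    and T21: "k * T21 = - (Yd + VD + DV + \<gamma> * \<delta> * (2 * g00 * gd) * Q0 + \<gamma> * \<delta> * g00\<^sup>2 * Qd)"
  shows "\<i> * k * (T12 - T21) = H * Q0 + (\<gamma> + \<delta>) * QF"
proof -
  \<comment> \<open>The factors \<open>k\<close> and \<open>\<i>\<close> are moved onto the
    individual derivatives, each of which is given by the hypotheses only together with one of
    them.\<close>
  have "\<i> * k * T12 = k * (\<i> * T12)" by simp
  also have "\<dots> = \<gamma> * (k * L0) * A0 * Qm + A0 * (k * Em) + \<delta> * (k * L1) * B1 * Qp + B1 * (k * Ep)
      + (k * W) * Q0 + w0 * (k * E0)"
    unfolding T12 by (simp add: algebra_simps)
  finally have 1: "\<i> * k * T12 = \<dots>" .
  have "\<i> * k * T21 = \<i> * (k * T21)" by simp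
  also have "\<dots> = - (\<i> * Yd + \<i> * VD + \<i> * DV + \<gamma> * \<delta> * (2 * g00 * (\<i> * gd)) * Q0 + \<gamma> * \<delta> * g00\<^sup>2 * (\<i> * Qd))"
    unfolding T21 by (simp add: algebra_simps)
  finally have 2: "\<i> * k * T21 = \<dots>" .
  \<comment> \<open>After substitution the remaining symbols are treated as independent, and the
    claim is a polynomial identity settled by expansion.\<close>
  show ?thesis
    unfolding right_diff_distrib 1 2 L0 L1 W Em E0 Ep Yd VD DV gd Qd lm lp lm' lp'
    by (simp add: algebra_simps power2_eq_square)
qed

section \<open>Second time derivatives\<close>

lemma displace_sel [simp]:
  "q (displace s \<epsilon> d) n y = q s n y + \<epsilon> *\<^sub>R q d n y"
  "r (displace s \<epsilon> d) n y = r s n y + \<epsilon> *\<^sub>R r d n y"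
  "logu (displace s \<epsilon> d) n y = logu s n y + \<epsilon> *\<^sub>R logu d n y"
  "v (displace s \<epsilon> d) n y = v s n y + \<epsilon> *\<^sub>R v d n y"
  "w (displace s \<epsilon> d) n y = w s n y + \<epsilon> *\<^sub>R w d n y"
  by (simp_all add: displace_def)

text \<open>A displaced field may violate the constraints, but the flow equations are available at
  every smooth field; hence they may be used along the whole line on which a time derivative is
  taken.\<close>

lemma smooth_displace: "smooth_fields s \<Longrightarrow> smooth_fields d \<Longrightarrow> smooth_fields (displace s \<epsilon> d)"
  unfolding smooth_fields_def displace_def fields.select_convs
  by (intro allI conjI smooth_intros) simp_all

lemma has_vector_derivative_line: "((\<lambda>\<epsilon>. x + \<epsilon> *\<^sub>R d) has_vector_derivative d) (at t)"
  by (auto intro!: derivative_eq_intros)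

lemma time_deriv_field:
  "time_deriv X (\<lambda>s. q s n y) = (\<lambda>s. q (X s) n y)"
  "time_deriv X (\<lambda>s. r s n y) = (\<lambda>s. r (X s) n y)"
  by (auto simp: fun_eq_iff time_deriv_def intro!: pd_eq has_vector_derivative_line)

lemma pd_pd_line:
  fixes f g :: "real \<Rightarrow> 'a::real_normed_vector"
  assumes "smooth f" "smooth g"
  shows "pd (pd (\<lambda>z. f z + \<epsilon> *\<^sub>R g z)) y = pd (pd f) y + \<epsilon> *\<^sub>R pd (pd g) y"
proof -
  have "pd (\<lambda>z. f z + \<epsilon> *\<^sub>R g z) y = pd f y + \<epsilon> *\<^sub>R pd g y" if "smooth f" "smooth g" for f g :: "real \<Rightarrow> 'a" and y
    by (rule pd_eq) (auto intro!: derivative_eq_intros smooth_has_pd that)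
  then show ?thesis by (simp add: assms smooth_pd)
qed

lemma t1_flow_q:
  assumes "t1_flow \<alpha> \<beta> \<gamma> \<delta> F s d"
  shows "q d n y = (- \<i>) *s ((\<alpha> * upow s \<gamma> n y) *s q s (n-1) y
    + (\<beta> * upow s \<delta> (n+1) y) *s q s (n+1) y + w s n y *s q s n y)"
proof -
  have "\<i> *s q d n y = (\<alpha> * upow s \<gamma> n y) *s q s (n-1) y
    + (\<beta> * upow s \<delta> (n+1) y) *s q s (n+1) y + w s n y *s q s n y"
    using assms unfolding t1_flow_def by (simp add: diff_diff_eq)
  from arg_cong[OF this, of "\<lambda>x. (- \<i>) *s x"] show ?thesis by simp
qed

lemma t1_flow_r:
  assumes "t1_flow \<alpha> \<beta> \<gamma> \<delta> F s d"
  shows "r d n y = \<i> *s ((\<beta> * upow s \<delta> n y) *s r s (n-1) y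
    + (\<alpha> * upow s \<gamma> (n+1) y) *s r s (n+1) y + w s n y *s r s n y)"
proof -
  have "\<i> *s r d n y + (\<beta> * upow s \<delta> n y) *s r s (n-1) y
    + (\<alpha> * upow s \<gamma> (n+1) y) *s r s (n+1) y + w s n y *s r s n y = 0"
    using assms unfolding t1_flow_def by blast
  then have "\<i> *s r d n y = - ((\<beta> * upow s \<delta> n y) *s r s (n-1) y
    + (\<alpha> * upow s \<gamma> (n+1) y) *s r s (n+1) y + w s n y *s r s n y)"
    by (simp only: eq_neg_iff_add_eq_0 add.assoc)
  from arg_cong[OF this, of "\<lambda>x. (- \<i>) *s x"] show ?thesis
    by (simp add: vec_eq_iff algebra_simps)
qed

lemma t2_flow_q:
  assumes "t2_flow \<alpha> \<beta> \<gamma> \<delta> k H s d"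
  shows "k *s q d n y = - (pd (pd (q s n)) y + q s n y v* (smat \<gamma> (v s n y) + smat \<delta> (v s (n+1) y))
       + (\<gamma> * \<delta> * (qr s n n y)\<^sup>2) *s q s n y)"
proof -
  have "k *s q d n y + pd (pd (q s n)) y + q s n y v* (smat \<gamma> (v s n y) + smat \<delta> (v s (n+1) y))
       + (\<gamma> * \<delta> * (qr s n n y)\<^sup>2) *s q s n y = 0"
    using assms unfolding t2_flow_def by blast
  then show ?thesis by (simp only: eq_neg_iff_add_eq_0 add.assoc)
qed

text \<open>\<open>X1\<close> is not known as a whole, but the flow gives its
  \<open>q\<close>-component explicitly at every displaced field, and this expression is
  differentiated along the arbitrary direction \<open>X s\<close>.\<close>

lemma time_deriv_t1_q:
  assumes s: "smooth_fields s" and d: "smooth_fields (X s)"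
    and X1: "\<And>s. smooth_fields s \<Longrightarrow> t1_flow \<alpha> \<beta> \<gamma> \<delta> F s (X1 s)"
  shows "\<i> *s time_deriv X (time_deriv X1 (\<lambda>s. q s n y)) s =
    (\<gamma> * logu (X s) n y * (\<alpha> * upow s \<gamma> n y)) *s q s (n-1) y + (\<alpha> * upow s \<gamma> n y) *s q (X s) (n-1) y
    + (\<delta> * logu (X s) (n+1) y * (\<beta> * upow s \<delta> (n+1) y)) *s q s (n+1) y
    + (\<beta> * upow s \<delta> (n+1) y) *s q (X s) (n+1) y + w (X s) n y *s q s n y + w s n y *s q (X s) n y"
    (is "_ = ?R")
proof -
  note line = has_vector_derivative_line
  have "((\<lambda>\<epsilon>. q (X1 (displace s \<epsilon> (X s))) n y) has_vector_derivative (- \<i>) *s ?R) (at 0)"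
    unfolding t1_flow_q[OF X1[OF smooth_displace[OF s d]]] upow_def displace_sel
    by (rule has_vector_derivative_eq_rhs, (rule line vector_derivative_rules)+)
      (simp add: vec_eq_iff algebra_simps)
  then show ?thesis
    by (simp add: time_deriv_field) (simp add: time_deriv_def pd_eq)
qed

lemma time_deriv_t2_q:
  assumes s: "smooth_fields s" and d: "smooth_fields (X s)" and k: "k \<noteq> 0"
    and X2: "\<And>s. smooth_fields s \<Longrightarrow> t2_flow \<alpha> \<beta> \<gamma> \<delta> k H s (X2 s)"
  shows "k *s time_deriv X (time_deriv X2 (\<lambda>s. q s n y)) s =
    - (pd (pd (q (X s) n)) y + q (X s) n y v* (smat \<gamma> (v s n y) + smat \<delta> (v s (n+1) y))
      + q s n y v* (smat \<gamma> (v (X s) n y) + smat \<delta> (v (X s) (n+1) y))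
      + (\<gamma> * \<delta> * (2 * qr s n n y * (row_col (q (X s) n y) (r s n y) + row_col (q s n y) (r (X s) n y)))) *s q s n y
      + (\<gamma> * \<delta> * (qr s n n y)\<^sup>2) *s q (X s) n y)"
    (is "_ = ?R")
proof -
  note line = has_vector_derivative_line
  have sm: "smooth (q s n)" "smooth (q (X s) n)" using s d by (simp_all add: smooth_fields_def)
  have e: "pd (pd (q (displace s \<epsilon> (X s)) n)) y = pd (pd (q s n)) y + \<epsilon> *\<^sub>R pd (pd (q (X s) n)) y" for \<epsilon>
    using pd_pd_line[OF sm] by (simp add: displace_def)
  \<comment> \<open>The square is written as a product so that the product rule in
    \<open>vector_derivative_rules\<close> applies to it.\<close>
  have flow: "q d n y = (1 / k) *s (- (pd (pd (q s n)) y + q s n y v* (smat \<gamma> (v s n y) + smat \<delta> (v s (n+1) y))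
       + (\<gamma> * \<delta> * (qr s n n y * qr s n n y)) *s q s n y))" if "t2_flow \<alpha> \<beta> \<gamma> \<delta> k H s d" for s d
    using arg_cong[OF t2_flow_q[OF that, of n y], of "\<lambda>x. (1 / k) *s x"] k
    by (simp add: power2_eq_square)
  have "((\<lambda>\<epsilon>. q (X2 (displace s \<epsilon> (X s))) n y) has_vector_derivative (1 / k) *s ?R) (at 0)"
    unfolding flow[OF X2[OF smooth_displace[OF s d]]] e displace_sel
    by (rule has_vector_derivative_eq_rhs, (rule line vector_derivative_rules)+)
      (simp add: vec_eq_iff algebra_simps vector_matrix_mult_add_rdistrib vector_matrix_smat power2_eq_square)
  then show ?thesis
    using k by (simp add: time_deriv_field) (simp add: time_deriv_def pd_eq)
qed

section \<open>The \<open>y\<close>-derivatives of fields that satisfy the constraints\<close>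

context
  fixes s :: "'m::finite fields" and \<alpha> \<beta> \<gamma> \<delta> :: complex
  assumes smooth_s: "smooth_fields s" and constr: "constraints \<alpha> \<beta> \<gamma> \<delta> s"
begin

lemma q_deriv: "(q s n has_vector_derivative pd (q s n) y) (at y)"
  and q_deriv2: "(pd (q s n) has_vector_derivative pd (pd (q s n)) y) (at y)"
  and r_deriv: "(r s n has_vector_derivative pd (r s n) y) (at y)"
  using smooth_s by (auto simp: smooth_fields_def intro!: smooth_has_pd smooth_pd)

text \<open>The constraint concerns \<open>u\<close>; dividing by the exponential, which never
  vanishes, turns it into one for the logarithm and thereby for every power of
  \<open>u\<close>.\<close>

lemma logu_deriv: "(logu s n has_vector_derivative qr s (n-1) (n-1) y - qr s n n y) (at y)"
proof -
  have d: "(logu s n has_vector_derivative pd (logu s n) y) (at y)"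
    using smooth_s by (auto simp: smooth_fields_def intro!: smooth_has_pd)
  have "pd (u s n) y = pd (logu s n) y * u s n y"
    unfolding u_def[abs_def] by (intro pd_eq has_vector_derivative_exp d)
  moreover have "pd (u s n) y = u s n y * (qr s (n-1) (n-1) y - qr s n n y)"
    using constr unfolding constraints_def by blast
  ultimately have "pd (logu s n) y = qr s (n-1) (n-1) y - qr s n n y"
    by (simp add: u_def)
  with d show ?thesis by simp
qed

lemma upow_deriv:
  "(upow s c n has_vector_derivative c * (qr s (n-1) (n-1) y - qr s n n y) * upow s c n y) (at y)"
  unfolding upow_def[abs_def]
  by (rule has_vector_derivative_eq_rhs, (rule logu_deriv vector_derivative_rules)+) simp

lemma w_deriv: "(w s n has_vector_derivative
   \<alpha> * \<delta> * (upow s \<gamma> n y * qr s (n-1) n y - upow s \<gamma> (n+1) y * qr s n (n+1) y)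
   + \<beta> * \<gamma> * (upow s \<delta> n y * qr s n (n-1) y - upow s \<delta> (n+1) y * qr s (n+1) n y)) (at y)"
proof -
  have "(w s n has_vector_derivative pd (w s n) y) (at y)"
    using smooth_s by (auto simp: smooth_fields_def intro!: smooth_has_pd)
  with constr show ?thesis unfolding constraints_def by simp
qed

lemmas y_rules = q_deriv q_deriv2 r_deriv upow_deriv w_deriv vector_derivative_rules

text \<open>Moves every \<open>v\<close> to the site \<open>n\<close>. The second flow at
  \<open>n - 1\<close>, \<open>n\<close> and \<open>n + 1\<close> involves \<open>v\<close> from
  \<open>n - 1\<close> up to \<open>n + 2\<close>; after the shifts only products of
  \<open>q\<close> with the one matrix at \<open>n\<close> are left, and these can cancel.\<close>

lemma v_shift:
  "x v* v s (n+1) y = x v* v s n y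
     - 2 *s (row_col x (pd (r s n) y) *s q s n y + row_col x (r s n y) *s pd (q s n) y)"
proof -
  have "pd (\<lambda>z. col_row (r s n z) (q s n z)) y = col_row (r s n y) (pd (q s n) y) + col_row (pd (r s n) y) (q s n y)"
    by (rule pd_eq) (rule y_rules)+
  moreover have "v s (n+1) y - v s n y = smat (-2) (pd (\<lambda>z. col_row (r s n z) (q s n z)) y)"
    using constr unfolding constraints_def by blast
  ultimately have e: "v s (n+1) y = v s n y + smat (-2) (col_row (r s n y) (pd (q s n) y) + col_row (pd (r s n) y) (q s n y))"
    by (simp add: algebra_simps)
  show ?thesis
    unfolding e
    by (simp add: vector_matrix_mult_add_rdistrib vector_matrix_smat vector_matrix_col_row vec_eq_iff algebra_simps)
qed

lemma v_shift_back:
  "x v* v s (n-1) y = x v* v s n y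
     + 2 *s (row_col x (pd (r s (n-1)) y) *s q s (n-1) y + row_col x (r s (n-1) y) *s pd (q s (n-1)) y)"
  using v_shift[of x "n-1" y] by simp

lemma v_t1:
  assumes flow: "t1_flow \<alpha> \<beta> \<gamma> \<delta> F s d"
  shows "\<i> *s (x v* v d n y) = (2 * \<alpha> * upow s \<gamma> n y) *s
      ((\<gamma> * (qr s (n-1) (n-1) y - qr s n n y) * row_col x (r s n y)) *s q s (n-1) y
        + row_col x (pd (r s n) y) *s q s (n-1) y + row_col x (r s n y) *s pd (q s (n-1)) y)
    - (2 * \<beta> * upow s \<delta> n y) *s
      ((\<delta> * (qr s (n-1) (n-1) y - qr s n n y) * row_col x (r s (n-1) y)) *s q s n y
        + row_col x (pd (r s (n-1)) y) *s q s n y + row_col x (r s (n-1) y) *s pd (q s n) y)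
    + x v* F y"
proof -
  let ?l = "qr s (n-1) (n-1) y - qr s n n y"
  have pd: "pd (\<lambda>z. smat (\<alpha> * upow s \<gamma> n z) (col_row (r s n z) (q s (n-1) z))
                     - smat (\<beta> * upow s \<delta> n z) (col_row (r s (n-1) z) (q s n z))) y =
      smat (\<alpha> * upow s \<gamma> n y) (col_row (r s n y) (pd (q s (n-1)) y) + col_row (pd (r s n) y) (q s (n-1) y))
      + smat (\<alpha> * (\<gamma> * ?l * upow s \<gamma> n y)) (col_row (r s n y) (q s (n-1) y))
      - (smat (\<beta> * upow s \<delta> n y) (col_row (r s (n-1) y) (pd (q s n) y) + col_row (pd (r s (n-1)) y) (q s n y))
      + smat (\<beta> * (\<delta> * ?l * upow s \<delta> n y)) (col_row (r s (n-1) y) (q s n y)))"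
    by (rule pd_eq, rule has_vector_derivative_eq_rhs, (rule y_rules)+) simp
  have "\<i> *s (x v* v d n y) = x v* smat \<i> (v d n y)"
    by (simp add: vector_matrix_smat)
  also have "smat \<i> (v d n y) = smat 2 (pd (\<lambda>z. smat (\<alpha> * upow s \<gamma> n z) (col_row (r s n z) (q s (n-1) z))
                     - smat (\<beta> * upow s \<delta> n z) (col_row (r s (n-1) z) (q s n z))) y) + F y"
    using flow unfolding t1_flow_def by blast
  finally show ?thesis
    unfolding pd
    by (simp add: vector_matrix_mult_add_rdistrib vector_matrix_mult_diff_rdistrib vector_matrix_smat vector_matrix_col_row
        vec_eq_iff algebra_simps)
qed

text \<open>Here \<open>l\<close> is the \<open>y\<close>-derivative of \<open>logu\<close> and
  \<open>g'\<close> that of the scalar products. The long coefficient of \<open>q s n y\<close> is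
  the second derivative of \<open>w\<close>, obtained by differentiating its constraint.\<close>

lemma q_t1_yy:
  fixes n :: int and y :: real
  assumes flow: "t1_flow \<alpha> \<beta> \<gamma> \<delta> F s d"
  defines "A \<equiv> \<lambda>n. \<alpha> * upow s \<gamma> n y" and "B \<equiv> \<lambda>n. \<beta> * upow s \<delta> n y"
    and "l \<equiv> \<lambda>n. qr s (n-1) (n-1) y - qr s n n y"
    and "g' \<equiv> \<lambda>l m. row_col (pd (q s l) y) (r s m y) + row_col (q s l y) (pd (r s m) y)"
  shows "\<i> *s pd (pd (q d n)) y =
      (A n * (\<gamma> * l n)\<^sup>2 + A n * \<gamma> * (g' (n-1) (n-1) - g' n n)) *s q s (n-1) y
      + (2 * A n * \<gamma> * l n) *s pd (q s (n-1)) y + A n *s pd (pd (q s (n-1))) y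
      + (B (n+1) * (\<delta> * l (n+1))\<^sup>2 + B (n+1) * \<delta> * (g' n n - g' (n+1) (n+1))) *s q s (n+1) y
      + (2 * B (n+1) * \<delta> * l (n+1)) *s pd (q s (n+1)) y + B (n+1) *s pd (pd (q s (n+1))) y
      + (\<delta> * (A n * \<gamma> * l n * qr s (n-1) n y + A n * g' (n-1) n
            - A (n+1) * \<gamma> * l (n+1) * qr s n (n+1) y - A (n+1) * g' n (n+1))
         + \<gamma> * (B n * \<delta> * l n * qr s n (n-1) y + B n * g' n (n-1)
            - B (n+1) * \<delta> * l (n+1) * qr s (n+1) n y - B (n+1) * g' (n+1) n)) *s q s n y
      + (2 * (\<delta> * (A n * qr s (n-1) n y - A (n+1) * qr s n (n+1) y)
          + \<gamma> * (B n * qr s n (n-1) y - B (n+1) * qr s (n+1) n y))) *s pd (q s n) y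
      + w s n y *s pd (pd (q s n)) y"
proof -
  have q: "q d n = (\<lambda>y. (- \<i>) *s ((\<alpha> * upow s \<gamma> n y) *s q s (n-1) y
    + (\<beta> * upow s \<delta> (n+1) y) *s q s (n+1) y + w s n y *s q s n y))"
    by (rule ext) (rule t1_flow_q[OF flow])
  let ?l = "\<lambda>n z. qr s (n-1) (n-1) z - qr s n n z"
  let ?wy = "\<lambda>z. \<alpha> * \<delta> * (upow s \<gamma> n z * qr s (n-1) n z - upow s \<gamma> (n+1) z * qr s n (n+1) z)
    + \<beta> * \<gamma> * (upow s \<delta> n z * qr s n (n-1) z - upow s \<delta> (n+1) z * qr s (n+1) n z)"
  have pd: "pd (q d n) = (\<lambda>z. (- \<i>) *s (
      (\<alpha> * upow s \<gamma> n z) *s pd (q s (n-1)) z + (\<alpha> * (\<gamma> * ?l n z * upow s \<gamma> n z)) *s q s (n-1) z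
    + ((\<beta> * upow s \<delta> (n+1) z) *s pd (q s (n+1)) z + (\<beta> * (\<delta> * ?l (n+1) z * upow s \<delta> (n+1) z)) *s q s (n+1) z)
    + (w s n z *s pd (q s n) z + ?wy z *s q s n z)))"
    unfolding q
    by (rule ext, rule pd_eq, rule has_vector_derivative_eq_rhs, (rule y_rules)+) simp
  have "\<i> *s pd (pd (q d n)) y = \<i> *s ((- \<i>) *s (
      (A n * (\<gamma> * l n)\<^sup>2 + A n * \<gamma> * (g' (n-1) (n-1) - g' n n)) *s q s (n-1) y
      + (2 * A n * \<gamma> * l n) *s pd (q s (n-1)) y + A n *s pd (pd (q s (n-1))) y
      + (B (n+1) * (\<delta> * l (n+1))\<^sup>2 + B (n+1) * \<delta> * (g' n n - g' (n+1) (n+1))) *s q s (n+1) y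
      + (2 * B (n+1) * \<delta> * l (n+1)) *s pd (q s (n+1)) y + B (n+1) *s pd (pd (q s (n+1))) y
      + (\<delta> * (A n * \<gamma> * l n * qr s (n-1) n y + A n * g' (n-1) n
            - A (n+1) * \<gamma> * l (n+1) * qr s n (n+1) y - A (n+1) * g' n (n+1))
         + \<gamma> * (B n * \<delta> * l n * qr s n (n-1) y + B n * g' n (n-1)
            - B (n+1) * \<delta> * l (n+1) * qr s (n+1) n y - B (n+1) * g' (n+1) n)) *s q s n y
      + (2 * (\<delta> * (A n * qr s (n-1) n y - A (n+1) * qr s n (n+1) y)
          + \<gamma> * (B n * qr s n (n-1) y - B (n+1) * qr s (n+1) n y))) *s pd (q s n) y
      + w s n y *s pd (pd (q s n)) y))"
    unfolding pd
    by (rule arg_cong[where f="\<lambda>x. \<i> *s x"], rule pd_eq, rule has_vector_derivative_eq_rhs, (rule y_rules)+)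
      (simp add: A_def B_def l_def g'_def vec_eq_iff algebra_simps power2_eq_square)
  then show ?thesis by simp
qed

text \<open>Each component \<open>j\<close> is an instance of \<open>commutator_identity\<close>.
  Smoothness of \<open>X1 s\<close> and \<open>X2 s\<close> enters because the displaced fields have
  to stay smooth.\<close>

lemma q_commutator:
  assumes X1: "\<And>s. smooth_fields s \<Longrightarrow> smooth_fields (X1 s) \<and> t1_flow \<alpha> \<beta> \<gamma> \<delta> F s (X1 s)"
    and X2: "\<And>s. smooth_fields s \<Longrightarrow> smooth_fields (X2 s) \<and> t2_flow \<alpha> \<beta> \<gamma> \<delta> k H s (X2 s)"
    and k: "k \<noteq> 0"
  shows "(\<i> * k) *s (time_deriv X2 (time_deriv X1 (\<lambda>s. q s n y)) s - time_deriv X1 (time_deriv X2 (\<lambda>s. q s n y)) s)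
    = H n *s q s n y + (\<gamma> + \<delta>) *s (q s n y v* F y)"
proof -
  define T12 where "T12 = time_deriv X2 (time_deriv X1 (\<lambda>s. q s n y)) s"
  define T21 where "T21 = time_deriv X1 (time_deriv X2 (\<lambda>s. q s n y)) s"
  let ?d1 = "X1 s" and ?d2 = "X2 s"
  have flow1: "t1_flow \<alpha> \<beta> \<gamma> \<delta> F s ?d1" and flow2: "t2_flow \<alpha> \<beta> \<gamma> \<delta> k H s ?d2"
    using X1 X2 smooth_s by blast+
  have d: "smooth_fields ?d1" "smooth_fields ?d2"
    using X1 X2 smooth_s by blast+
  let ?q = "\<lambda>l j. q s l y $ j" and ?p = "\<lambda>l j. pd (q s l) y $ j" and ?pp = "\<lambda>l j. pd (pd (q s l)) y $ j"
  let ?g = "\<lambda>l m. qr s l m y" and ?x = "\<lambda>l m. row_col (pd (q s l) y) (r s m y)"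
    and ?z = "\<lambda>l m. row_col (q s l y) (pd (r s m) y)"
  let ?A = "\<lambda>n. \<alpha> * upow s \<gamma> n y" and ?B = "\<lambda>n. \<beta> * upow s \<delta> n y"
  note vm = vector_matrix_mult_add_rdistrib vector_matrix_smat scalar_vector_matrix_assoc
  note q1 = t1_flow_q[OF flow1, of n y] and q2 = t2_flow_q[OF flow2, of _ y]
  have L: "k * logu ?d2 m y = (?x m m - ?z m m + (\<gamma> - \<delta>) * (?g m m)\<^sup>2)
      - (?x (m-1) (m-1) - ?z (m-1) (m-1) + (\<gamma> - \<delta>) * (?g (m-1) (m-1))\<^sup>2)" for m
    using flow2 unfolding t2_flow_def by blast
  have W: "k * w ?d2 n y =
      \<gamma> * ?B n * (- ?x n (n-1) + ?z n (n-1) + \<delta> * (?g (n-1) (n-1) + ?g n n) * ?g n (n-1))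
      - \<gamma> * ?B (n+1) * (- ?x (n+1) n + ?z (n+1) n + \<delta> * (?g n n + ?g (n+1) (n+1)) * ?g (n+1) n)
      + \<delta> * ?A n * (- ?x (n-1) n + ?z (n-1) n - \<gamma> * (?g (n-1) (n-1) + ?g n n) * ?g (n-1) n)
      - \<delta> * ?A (n+1) * (- ?x n (n+1) + ?z n (n+1) - \<gamma> * (?g n n + ?g (n+1) (n+1)) * ?g n (n+1)) + H n"
  proof -
    have "k * w ?d2 n y =
      \<beta> * \<gamma> * upow s \<delta> n y * (- ?x n (n-1) + ?z n (n-1) + \<delta> * (?g (n-1) (n-1) + ?g n n) * ?g n (n-1))
      - \<beta> * \<gamma> * upow s \<delta> (n+1) y * (- ?x (n+1) n + ?z (n+1) n + \<delta> * (?g n n + ?g (n+1) (n+1)) * ?g (n+1) n)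
      + \<alpha> * \<delta> * upow s \<gamma> n y * (- ?x (n-1) n + ?z (n-1) n - \<gamma> * (?g (n-1) (n-1) + ?g n n) * ?g (n-1) n)
      - \<alpha> * \<delta> * upow s \<gamma> (n+1) y * (- ?x n (n+1) + ?z n (n+1) - \<gamma> * (?g n n + ?g (n+1) (n+1)) * ?g n (n+1)) + H n"
      using flow2 unfolding t2_flow_def by blast
    then show ?thesis by (simp only: mult_ac)
  qed
  have "(\<i> * k) * (T12 $ j - T21 $ j) = H n * ?q n j + (\<gamma> + \<delta>) * (q s n y v* F y) $ j" for j
  proof (rule commutator_identity)
    show "k * logu ?d2 n y = (?x n n - ?z n n + (\<gamma> - \<delta>) * (?g n n)\<^sup>2)
      - (?x (n-1) (n-1) - ?z (n-1) (n-1) + (\<gamma> - \<delta>) * (?g (n-1) (n-1))\<^sup>2)"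
      by (rule L)
    show "k * logu ?d2 (n+1) y = (?x (n+1) (n+1) - ?z (n+1) (n+1) + (\<gamma> - \<delta>) * (?g (n+1) (n+1))\<^sup>2)
      - (?x n n - ?z n n + (\<gamma> - \<delta>) * (?g n n)\<^sup>2)"
      using L[of "n+1"] by simp
    show "k * w ?d2 n y =
      \<gamma> * ?B n * (- ?x n (n-1) + ?z n (n-1) + \<delta> * (?g (n-1) (n-1) + ?g n n) * ?g n (n-1))
      - \<gamma> * ?B (n+1) * (- ?x (n+1) n + ?z (n+1) n + \<delta> * (?g n n + ?g (n+1) (n+1)) * ?g (n+1) n)
      + \<delta> * ?A n * (- ?x (n-1) n + ?z (n-1) n - \<gamma> * (?g (n-1) (n-1) + ?g n n) * ?g (n-1) n)
      - \<delta> * ?A (n+1) * (- ?x n (n+1) + ?z n (n+1) - \<gamma> * (?g n n + ?g (n+1) (n+1)) * ?g n (n+1)) + H n"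
      by (rule W)
    show "k * (q ?d2 (n-1) y $ j) = - (?pp (n-1) j
      + \<gamma> * ((q s (n-1) y v* v s n y) $ j + 2 * (?z (n-1) (n-1) * ?q (n-1) j + ?g (n-1) (n-1) * ?p (n-1) j))
      + \<delta> * (q s (n-1) y v* v s n y) $ j + \<gamma> * \<delta> * (?g (n-1) (n-1))\<^sup>2 * ?q (n-1) j)"
      using arg_cong[OF q2[of "n-1"], of "\<lambda>x. x $ j"]
      by (simp add: vm v_shift_back algebra_simps)
    show "k * (q ?d2 n y $ j) = - (?pp n j + \<gamma> * (q s n y v* v s n y) $ j
      + \<delta> * ((q s n y v* v s n y) $ j - 2 * (?z n n * ?q n j + ?g n n * ?p n j)) + \<gamma> * \<delta> * (?g n n)\<^sup>2 * ?q n j)"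
      using arg_cong[OF q2[of n], of "\<lambda>x. x $ j"]
      unfolding vm v_shift by (simp add: algebra_simps)
    \<comment> \<open>The second flow at \<open>n + 1\<close> contains \<open>v\<close> at
      \<open>n + 2\<close>, which takes two shifts to reach \<open>n\<close>.\<close>
    show "k * (q ?d2 (n+1) y $ j) = - (?pp (n+1) j
      + \<gamma> * ((q s (n+1) y v* v s n y) $ j - 2 * (?z (n+1) n * ?q n j + ?g (n+1) n * ?p n j))
      + \<delta> * ((q s (n+1) y v* v s n y) $ j - 2 * (?z (n+1) n * ?q n j + ?g (n+1) n * ?p n j)
         - 2 * (?z (n+1) (n+1) * ?q (n+1) j + ?g (n+1) (n+1) * ?p (n+1) j))
      + \<gamma> * \<delta> * (?g (n+1) (n+1))\<^sup>2 * ?q (n+1) j)"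
      using arg_cong[OF q2[of "n+1"], of "\<lambda>x. x $ j"]
      unfolding vm v_shift by (simp add: algebra_simps)
    show "\<i> * T12 $ j = \<gamma> * logu ?d2 n y * ?A n * ?q (n-1) j + ?A n * (q ?d2 (n-1) y $ j)
      + \<delta> * logu ?d2 (n+1) y * ?B (n+1) * ?q (n+1) j + ?B (n+1) * (q ?d2 (n+1) y $ j)
      + w ?d2 n y * ?q n j + w s n y * (q ?d2 n y $ j)"
      using arg_cong[OF time_deriv_t1_q[where X = X2, OF smooth_s d(2) X1[THEN conjunct2]], of "\<lambda>x. x $ j" n y]
      by (simp add: T12_def algebra_simps)
    show "\<i> * pd (pd (q ?d1 n)) y $ j =
      (?A n * (\<gamma> * (?g (n-1) (n-1) - ?g n n))\<^sup>2
         + ?A n * \<gamma> * (?x (n-1) (n-1) + ?z (n-1) (n-1) - (?x n n + ?z n n))) * ?q (n-1) j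
      + 2 * ?A n * \<gamma> * (?g (n-1) (n-1) - ?g n n) * ?p (n-1) j + ?A n * ?pp (n-1) j
      + (?B (n+1) * (\<delta> * (?g n n - ?g (n+1) (n+1)))\<^sup>2
         + ?B (n+1) * \<delta> * (?x n n + ?z n n - (?x (n+1) (n+1) + ?z (n+1) (n+1)))) * ?q (n+1) j
      + 2 * ?B (n+1) * \<delta> * (?g n n - ?g (n+1) (n+1)) * ?p (n+1) j + ?B (n+1) * ?pp (n+1) j
      + (\<delta> * (?A n * \<gamma> * (?g (n-1) (n-1) - ?g n n) * ?g (n-1) n + ?A n * (?x (n-1) n + ?z (n-1) n)
            - ?A (n+1) * \<gamma> * (?g n n - ?g (n+1) (n+1)) * ?g n (n+1) - ?A (n+1) * (?x n (n+1) + ?z n (n+1)))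
         + \<gamma> * (?B n * \<delta> * (?g (n-1) (n-1) - ?g n n) * ?g n (n-1) + ?B n * (?x n (n-1) + ?z n (n-1))
            - ?B (n+1) * \<delta> * (?g n n - ?g (n+1) (n+1)) * ?g (n+1) n - ?B (n+1) * (?x (n+1) n + ?z (n+1) n))) * ?q n j
      + 2 * (\<delta> * (?A n * ?g (n-1) n - ?A (n+1) * ?g n (n+1))
          + \<gamma> * (?B n * ?g n (n-1) - ?B (n+1) * ?g (n+1) n)) * ?p n j
      + w s n y * ?pp n j"
      using arg_cong[OF q_t1_yy[OF flow1, of n y], of "\<lambda>x. x $ j"] by (simp add: algebra_simps)
    show "\<i> * (q ?d1 n y v* (smat \<gamma> (v s n y) + smat \<delta> (v s (n+1) y))) $ j =
      ?A n * ((\<gamma> + \<delta>) * (q s (n-1) y v* v s n y) $ j - 2 * \<delta> * (?z (n-1) n * ?q n j + ?g (n-1) n * ?p n j))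
      + ?B (n+1) * ((\<gamma> + \<delta>) * (q s (n+1) y v* v s n y) $ j - 2 * \<delta> * (?z (n+1) n * ?q n j + ?g (n+1) n * ?p n j))
      + w s n y * ((\<gamma> + \<delta>) * (q s n y v* v s n y) $ j - 2 * \<delta> * (?z n n * ?q n j + ?g n n * ?p n j))"
      unfolding q1 vm v_shift
      by (simp add: vm v_shift row_col_add row_col_diff row_col_scale row_col_minus algebra_simps)
    show "\<i> * (q s n y v* (smat \<gamma> (v ?d1 n y) + smat \<delta> (v ?d1 (n+1) y))) $ j =
      2 * \<gamma> * (?A n * \<gamma> * (?g (n-1) (n-1) - ?g n n) * ?g n n * ?q (n-1) j + ?A n * (?z n n * ?q (n-1) j + ?g n n * ?p (n-1) j)
        - ?B n * \<delta> * (?g (n-1) (n-1) - ?g n n) * ?g n (n-1) * ?q n j - ?B n * (?z n (n-1) * ?q n j + ?g n (n-1) * ?p n j))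
      + 2 * \<delta> * (?A (n+1) * \<gamma> * (?g n n - ?g (n+1) (n+1)) * ?g n (n+1) * ?q n j
        + ?A (n+1) * (?z n (n+1) * ?q n j + ?g n (n+1) * ?p n j)
        - ?B (n+1) * \<delta> * (?g n n - ?g (n+1) (n+1)) * ?g n n * ?q (n+1) j - ?B (n+1) * (?z n n * ?q (n+1) j + ?g n n * ?p (n+1) j))
      + (\<gamma> + \<delta>) * (q s n y v* F y) $ j"
    proof -
      have "\<i> * (q s n y v* (smat \<gamma> (v ?d1 n y) + smat \<delta> (v ?d1 (n+1) y))) $ j
        = \<gamma> * (\<i> *s (q s n y v* v ?d1 n y)) $ j + \<delta> * (\<i> *s (q s n y v* v ?d1 (n+1) y)) $ j"
        by (simp add: vm algebra_simps)
      then show ?thesis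
        unfolding v_t1[OF flow1] by (simp add: algebra_simps)
    qed
    show "\<i> * (row_col (q ?d1 n y) (r s n y) + row_col (q s n y) (r ?d1 n y)) =
      ?A n * ?g (n-1) n + ?B (n+1) * ?g (n+1) n - ?B n * ?g n (n-1) - ?A (n+1) * ?g n (n+1)"
      unfolding q1 t1_flow_r[OF flow1] by (simp add: row_col_add row_col_diff row_col_minus row_col_scale algebra_simps)
    show "\<i> * q ?d1 n y $ j = ?A n * ?q (n-1) j + ?B (n+1) * ?q (n+1) j + w s n y * ?q n j"
      unfolding q1 by (simp add: algebra_simps)
    show "k * T21 $ j = - (pd (pd (q ?d1 n)) y $ j + (q ?d1 n y v* (smat \<gamma> (v s n y) + smat \<delta> (v s (n+1) y))) $ j
      + (q s n y v* (smat \<gamma> (v ?d1 n y) + smat \<delta> (v ?d1 (n+1) y))) $ j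
      + \<gamma> * \<delta> * (2 * ?g n n * (row_col (q ?d1 n y) (r s n y) + row_col (q s n y) (r ?d1 n y))) * ?q n j
      + \<gamma> * \<delta> * (?g n n)\<^sup>2 * q ?d1 n y $ j)"
      using arg_cong[OF time_deriv_t2_q[where X = X1, OF smooth_s d(1) k X2[THEN conjunct2]], of "\<lambda>x. x $ j" n y]
      by (simp add: T21_def algebra_simps)
  \<comment> \<open>The premises left over only define \<open>lm\<close>, \<open>lp\<close>,
    \<open>lm'\<close> and \<open>lp'\<close>, which the preceding facts have already
    instantiated.\<close>
  qed simp_all
  then show ?thesis by (simp add: vec_eq_iff T12_def T21_def algebra_simps)
qed

end

section \<open>Duality between rows and columns\<close>

text \<open>Exchanging \<open>q\<close> with \<open>r\<close>, \<open>\<alpha>\<close> with \<open>\<beta>\<close>, \<open>\<gamma>\<close> with \<open>\<delta>\<close> and reversing both times maps the system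
  to itself; hence the commutator on \<open>r\<close> is obtained from that on \<open>q\<close>.\<close>

definition dual :: "'m::finite fields \<Rightarrow> 'm fields" where
  "dual s = \<lparr> q = r s, r = q s, logu = logu s, v = \<lambda>n y. transpose (v s n y), w = w s \<rparr>"

text \<open>The same exchange for time derivatives, where the reversal of time supplies the
  sign.\<close>

definition neg_dual :: "'m::finite fields \<Rightarrow> 'm fields" where
  "neg_dual s = \<lparr> q = \<lambda>n y. - r s n y, r = \<lambda>n y. - q s n y, logu = \<lambda>n y. - logu s n y,
     v = \<lambda>n y. - transpose (v s n y), w = \<lambda>n y. - w s n y \<rparr>"

lemma row_col_commute: "row_col x y = row_col y x"
  by (simp add: row_col_def mult.commute)

lemma transpose_rules:
  "transpose (col_row x y) = col_row y x"
  "transpose (smat c A) = smat c (transpose A)"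
  "transpose (A + B) = transpose A + transpose B"
  "transpose (A - B) = transpose A - transpose B"
  by (simp_all add: transpose_def col_row_def smat_def vec_eq_iff)

lemma smat_minus: "smat c (- A) = - smat c A"
  by (simp add: smat_def vec_eq_iff)

lemma bounded_linear_transpose: "bounded_linear (transpose :: complex^'m::finite^'m \<Rightarrow> _)"
  unfolding linear_conv_bounded_linear[symmetric] linear_iff
  by (auto simp: transpose_def vec_eq_iff)

lemma dual_dual [simp]: "dual (dual s) = s"
  by (simp add: dual_def)

lemma dual_sel [simp]: "q (dual s) = r s" "r (dual s) = q s" "logu (dual s) = logu s"
  "v (dual s) n y = transpose (v s n y)" "w (dual s) = w s" "upow (dual s) = upow s" "u (dual s) = u s"
  by (simp_all add: dual_def upow_def u_def fun_eq_iff)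

lemma smooth_fields_dual: "smooth_fields s \<Longrightarrow> smooth_fields (dual s)"
  and smooth_fields_neg_dual: "smooth_fields s \<Longrightarrow> smooth_fields (neg_dual s)"
  unfolding smooth_fields_def dual_def neg_dual_def fields.select_convs
  by (auto intro!: smooth_minus smooth_linear[OF bounded_linear_transpose])

lemma displace_dual: "displace (dual s) \<epsilon> (neg_dual d) = dual (displace s (- \<epsilon>) d)"
  by (simp add: displace_def dual_def neg_dual_def transpose_def vec_eq_iff fun_eq_iff)

lemma smooth_fieldsD:
  assumes "smooth_fields s"
  shows "smooth (q s n)" "smooth (r s n)" "smooth (logu s n)" "smooth (v s n)" "smooth (w s n)"
  using assms by (simp_all add: smooth_fields_def)

lemma smooth_upow: "smooth_fields s \<Longrightarrow> smooth (upow s c n)"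
  unfolding upow_def[abs_def] by (intro smooth_intros smooth_fieldsD)

lemma pd_transpose: "smooth f \<Longrightarrow> pd (\<lambda>z. transpose (f z)) y = transpose (pd f y)"
  for f :: "real \<Rightarrow> complex^'m::finite^'m"
  by (intro pd_eq bounded_linear.has_vector_derivative[OF bounded_linear_transpose] smooth_has_pd)

lemma pd_uminus: "smooth f \<Longrightarrow> pd (\<lambda>z. - f z) y = - pd f y"
  by (intro pd_eq has_vector_derivative_minus smooth_has_pd)

lemma constraints_dual:
  assumes s: "smooth_fields s" and c: "constraints \<alpha> \<beta> \<gamma> \<delta> s"
  shows "constraints \<beta> \<alpha> \<delta> \<gamma> (dual s)"
  unfolding constraints_def dual_sel
proof (intro allI conjI)
  fix n y
  show "pd (u s n) y = u s n y * (row_col (r s (n-1) y) (q s (n-1) y) - row_col (r s n y) (q s n y))"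
    using c unfolding constraints_def row_col_commute[of "r s _ _"] by blast
  have "pd (w s n) y =
       \<alpha> * \<delta> * (upow s \<gamma> n y * qr s (n-1) n y - upow s \<gamma> (n+1) y * qr s n (n+1) y)
       + \<beta> * \<gamma> * (upow s \<delta> n y * qr s n (n-1) y - upow s \<delta> (n+1) y * qr s (n+1) n y)"
    using c unfolding constraints_def by blast
  then show "pd (w s n) y =
       \<beta> * \<gamma> * (upow s \<delta> n y * row_col (r s (n-1) y) (q s n y) - upow s \<delta> (n+1) y * row_col (r s n y) (q s (n+1) y))
       + \<alpha> * \<delta> * (upow s \<gamma> n y * row_col (r s n y) (q s (n-1) y) - upow s \<gamma> (n+1) y * row_col (r s (n+1) y) (q s n y))"
    unfolding row_col_commute[of "r s _ _"] by simp
  have "v s (n+1) y - v s n y = smat (-2) (pd (\<lambda>z. col_row (r s n z) (q s n z)) y)"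
    using c unfolding constraints_def by blast
  then have "transpose (v s (n+1) y) - transpose (v s n y) = smat (-2) (transpose (pd (\<lambda>z. col_row (r s n z) (q s n z)) y))"
    by (metis transpose_rules(2,4))
  also have "transpose (pd (\<lambda>z. col_row (r s n z) (q s n z)) y) = pd (\<lambda>z. transpose (col_row (r s n z) (q s n z))) y"
    by (intro pd_transpose[symmetric] smooth_vector_intros smooth_fieldsD s)
  finally show "transpose (v s (n+1) y) - transpose (v s n y) = smat (-2) (pd (\<lambda>z. col_row (q s n z) (r s n z)) y)"
    by (simp add: transpose_rules)
qed

lemma t1_flow_dual:
  assumes s: "smooth_fields s" and f: "t1_flow \<alpha> \<beta> \<gamma> \<delta> F s d"
  shows "t1_flow \<beta> \<alpha> \<delta> \<gamma> (\<lambda>y. - transpose (F y)) (dual s) (neg_dual d)"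
  unfolding t1_flow_def dual_sel neg_dual_def fields.select_convs
proof (intro allI conjI)
  fix n y
  show "\<i> *s - r d n y - (\<beta> * upow s \<delta> n y) *s r s (n-1) y
       - (\<alpha> * upow s \<gamma> (n+1) y) *s r s (n+1) y - w s n y *s r s n y = 0"
    by (simp add: t1_flow_r[OF f] vec_eq_iff algebra_simps)
  show "\<i> *s - q d n y + (\<alpha> * upow s \<gamma> n y) *s q s (n-1) y
       + (\<beta> * upow s \<delta> (n+1) y) *s q s (n+1) y + w s n y *s q s n y = 0"
    by (simp add: t1_flow_q[OF f] vec_eq_iff algebra_simps)
  let ?P = "\<lambda>z. smat (\<alpha> * upow s \<gamma> n z) (col_row (r s n z) (q s (n-1) z))
                     - smat (\<beta> * upow s \<delta> n z) (col_row (r s (n-1) z) (q s n z))"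
  have P: "smooth ?P"
    by (intro smooth_vector_intros smooth_fieldsD smooth_upow s)
  have "pd (\<lambda>z. smat (\<beta> * upow s \<delta> n z) (col_row (q s n z) (r s (n-1) z))
                     - smat (\<alpha> * upow s \<gamma> n z) (col_row (q s (n-1) z) (r s n z))) y
      = pd (\<lambda>z. - transpose (?P z)) y"
    by (simp add: transpose_rules)
  also have "\<dots> = - transpose (pd ?P y)"
    by (simp add: pd_uminus pd_transpose P smooth_linear[OF bounded_linear_transpose])
  finally have pdP: "pd (\<lambda>z. smat (\<beta> * upow s \<delta> n z) (col_row (q s n z) (r s (n-1) z))
                     - smat (\<alpha> * upow s \<gamma> n z) (col_row (q s (n-1) z) (r s n z))) y = - transpose (pd ?P y)" .
  have "smat \<i> (v d n y) = smat 2 (pd ?P y) + F y"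
    using f unfolding t1_flow_def by blast
  from arg_cong[OF this, of "\<lambda>A. - transpose A"]
  show "smat \<i> (- transpose (v d n y)) =
       smat 2 (pd (\<lambda>z. smat (\<beta> * upow s \<delta> n z) (col_row (q s n z) (r s (n-1) z))
                     - smat (\<alpha> * upow s \<gamma> n z) (col_row (q s (n-1) z) (r s n z))) y)
       + - transpose (F y)"
    unfolding pdP by (simp add: smat_minus transpose_rules)
qed

lemma t2_flow_dual:
  assumes f: "t2_flow \<alpha> \<beta> \<gamma> \<delta> k H s d"
  shows "t2_flow \<beta> \<alpha> \<delta> \<gamma> k (\<lambda>n. - H n) (dual s) (neg_dual d)"
  unfolding t2_flow_def dual_sel neg_dual_def fields.select_convs
proof (intro allI conjI, goal_cases)
  case (1 n y)
  have "k *s r d n y - pd (pd (r s n)) y - (smat \<delta> (v s n y) + smat \<gamma> (v s (n+1) y)) *v r s n y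
       - (\<gamma> * \<delta> * (qr s n n y)\<^sup>2) *s r s n y = 0"
    using f unfolding t2_flow_def by blast
  then show ?case
    unfolding row_col_commute[of "r s _ _"] transpose_rules(2,3)[symmetric] vector_transpose_matrix
    by (simp add: vec_eq_iff algebra_simps)
next
  case (2 n y)
  have "k *s q d n y + pd (pd (q s n)) y + q s n y v* (smat \<gamma> (v s n y) + smat \<delta> (v s (n+1) y))
       + (\<gamma> * \<delta> * (qr s n n y)\<^sup>2) *s q s n y = 0"
    using f unfolding t2_flow_def by blast
  then show ?case
    unfolding row_col_commute[of "r s _ _"] transpose_rules(2,3)[symmetric] transpose_matrix_vector
    by (simp add: vec_eq_iff neg_eq_iff_add_eq_0 algebra_simps)
next
  case (3 n y)
  have "k * logu d n y =
       (row_col (pd (q s n) y) (r s n y) - row_col (q s n y) (pd (r s n) y)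
          + (\<gamma> - \<delta>) * (qr s n n y)\<^sup>2)
       - (row_col (pd (q s (n-1)) y) (r s (n-1) y) - row_col (q s (n-1) y) (pd (r s (n-1)) y)
          + (\<gamma> - \<delta>) * (qr s (n-1) (n-1) y)\<^sup>2)"
    using f unfolding t2_flow_def by blast
  then show ?case
    unfolding row_col_commute[of "r s _ _"] row_col_commute[of "pd (r s _) _"] mult_minus_right
    by (simp add: algebra_simps)
next
  case (4 n y)
  have "k * w d n y =
       \<beta> * \<gamma> * upow s \<delta> n y *
         (- row_col (pd (q s n) y) (r s (n-1) y) + row_col (q s n y) (pd (r s (n-1)) y)
          + \<delta> * (qr s (n-1) (n-1) y + qr s n n y) * qr s n (n-1) y)
       - \<beta> * \<gamma> * upow s \<delta> (n+1) y *
         (- row_col (pd (q s (n+1)) y) (r s n y) + row_col (q s (n+1) y) (pd (r s n) y)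
          + \<delta> * (qr s n n y + qr s (n+1) (n+1) y) * qr s (n+1) n y)
       + \<alpha> * \<delta> * upow s \<gamma> n y *
         (- row_col (pd (q s (n-1)) y) (r s n y) + row_col (q s (n-1) y) (pd (r s n) y)
          - \<gamma> * (qr s (n-1) (n-1) y + qr s n n y) * qr s (n-1) n y)
       - \<alpha> * \<delta> * upow s \<gamma> (n+1) y *
         (- row_col (pd (q s n) y) (r s (n+1) y) + row_col (q s n y) (pd (r s (n+1)) y)
          - \<gamma> * (qr s n n y + qr s (n+1) (n+1) y) * qr s n (n+1) y)
       + H n"
    using f unfolding t2_flow_def by blast
  then show ?case
    unfolding row_col_commute[of "r s _ _"] row_col_commute[of "pd (r s _) _"] mult_minus_right
    by (simp add: algebra_simps)
qed

text \<open>Both functions have the same vector derivatives at 0, reflection being an involution, so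
  the choice in \<open>vector_derivative\<close> agrees even where no derivative exists. The duality
  thus applies to arbitrary vector fields.\<close>

lemma vector_derivative_reflect:
  "vector_derivative (\<lambda>\<epsilon>. - f (- \<epsilon>)) (at 0) = vector_derivative f (at 0)"
proof -
  have m: "(uminus has_vector_derivative - 1) (at (0::real))"
    by (auto intro!: derivative_eq_intros)
  have *: "((\<lambda>\<epsilon>. - f (- \<epsilon>)) has_vector_derivative d) (at 0)" if "(f has_vector_derivative d) (at 0)" for f :: "real \<Rightarrow> 'a" and d
    using has_vector_derivative_minus[OF vector_diff_chain_at[OF m, of f d]] that
    by (simp add: o_def)
  have "((\<lambda>\<epsilon>. - f (- \<epsilon>)) has_vector_derivative d) (at 0) \<longleftrightarrow> (f has_vector_derivative d) (at 0)" for d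
    using *[of f d] *[of "\<lambda>\<epsilon>. - f (- \<epsilon>)" d] by auto
  then show ?thesis by (simp add: vector_derivative_def)
qed

lemma r_commutator:
  assumes s: "smooth_fields s" and c: "constraints \<alpha> \<beta> \<gamma> \<delta> s"
    and X1: "\<And>s. smooth_fields s \<Longrightarrow> smooth_fields (X1 s) \<and> t1_flow \<alpha> \<beta> \<gamma> \<delta> F s (X1 s)"
    and X2: "\<And>s. smooth_fields s \<Longrightarrow> smooth_fields (X2 s) \<and> t2_flow \<alpha> \<beta> \<gamma> \<delta> k H s (X2 s)"
    and k: "k \<noteq> 0"
  shows "(\<i> * k) *s (time_deriv X2 (time_deriv X1 (\<lambda>s. r s n y)) s - time_deriv X1 (time_deriv X2 (\<lambda>s. r s n y)) s)
    = - (H n *s r s n y + (\<gamma> + \<delta>) *s (F y *v r s n y))"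
proof -
  let ?Y = "\<lambda>X s. neg_dual (X (dual s))"
  \<comment> \<open>The minus sign from \<open>neg_dual\<close> and the reversed displacement
    compensate each other.\<close>
  have Y: "time_deriv (?Y X') (time_deriv (?Y X) (\<lambda>s. q s n y)) (dual s) = time_deriv X' (time_deriv X (\<lambda>s. r s n y)) s" for X X'
  proof -
    have "time_deriv (?Y X') (time_deriv (?Y X) (\<lambda>s. q s n y)) (dual s)
      = vector_derivative (\<lambda>\<epsilon>. - r (X (displace s (- \<epsilon>) (X' s))) n y) (at 0)"
      unfolding time_deriv_field unfolding time_deriv_def displace_dual by (simp add: displace_dual neg_dual_def)
    also have "\<dots> = time_deriv X' (time_deriv X (\<lambda>s. r s n y)) s"
      unfolding time_deriv_field unfolding time_deriv_def by (rule vector_derivative_reflect)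
    finally show ?thesis .
  qed
  have "(\<i> * k) *s (time_deriv (?Y X2) (time_deriv (?Y X1) (\<lambda>s. q s n y)) (dual s)
      - time_deriv (?Y X1) (time_deriv (?Y X2) (\<lambda>s. q s n y)) (dual s))
    = - H n *s q (dual s) n y + (\<delta> + \<gamma>) *s (q (dual s) n y v* - transpose (F y))"
  proof (rule q_commutator[OF smooth_fields_dual[OF s] constraints_dual[OF s c] _ _ k])
    fix s' :: "'a fields" assume "smooth_fields s'"
    then have s': "smooth_fields (dual s')" by (rule smooth_fields_dual)
    show "smooth_fields (?Y X1 s') \<and> t1_flow \<beta> \<alpha> \<delta> \<gamma> (\<lambda>y. - transpose (F y)) s' (?Y X1 s')"
      using t1_flow_dual[OF s'] X1[OF s'] by (auto intro: smooth_fields_neg_dual)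
    show "smooth_fields (?Y X2 s') \<and> t2_flow \<beta> \<alpha> \<delta> \<gamma> k (\<lambda>n. - H n) s' (?Y X2 s')"
      using t2_flow_dual X2[OF s'] by (fastforce intro: smooth_fields_neg_dual)
  qed
  moreover have "x v* - transpose A = - (A *v x)" for x :: "complex^'a" and A :: "complex^'a^'a"
    using vector_matrix_mult_diff_rdistrib[of x 0 "transpose A"] by simp
  ultimately show ?thesis
    unfolding Y by (simp add: vec_eq_iff algebra_simps)
qed

section \<open>The compatibility condition\<close>

text \<open>A concrete vector field to which the assumption of commuting derivatives can be applied.
  The derivatives of \<open>logu\<close> and \<open>w\<close>, left open by the flow, are set to
  0.\<close>

definition t1_field ::
  "complex \<Rightarrow> complex \<Rightarrow> complex \<Rightarrow> complex \<Rightarrow> (real \<Rightarrow> complex^'m::finite^'m) \<Rightarrow> 'm fields \<Rightarrow> 'm fields" where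
  "t1_field \<alpha> \<beta> \<gamma> \<delta> F s = \<lparr>
     q = \<lambda>n y. (- \<i>) *s ((\<alpha> * upow s \<gamma> n y) *s q s (n-1) y
       + (\<beta> * upow s \<delta> (n+1) y) *s q s (n+1) y + w s n y *s q s n y),
     r = \<lambda>n y. \<i> *s ((\<beta> * upow s \<delta> n y) *s r s (n-1) y
       + (\<alpha> * upow s \<gamma> (n+1) y) *s r s (n+1) y + w s n y *s r s n y),
     logu = \<lambda>n y. 0,
     v = \<lambda>n y. smat (- \<i>) (smat 2 (pd (\<lambda>z. smat (\<alpha> * upow s \<gamma> n z) (col_row (r s n z) (q s (n-1) z))
         - smat (\<beta> * upow s \<delta> n z) (col_row (r s (n-1) z) (q s n z))) y) + F y),
     w = \<lambda>n y. 0 \<rparr>"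

text \<open>The counterpart for the second flow; here the derivative of \<open>v\<close> is the one
  left open.\<close>

definition t2_field ::
  "complex \<Rightarrow> complex \<Rightarrow> complex \<Rightarrow> complex \<Rightarrow> complex \<Rightarrow> (int \<Rightarrow> complex) \<Rightarrow> 'm::finite fields \<Rightarrow> 'm fields" where
  "t2_field \<alpha> \<beta> \<gamma> \<delta> k H s = \<lparr>
     q = \<lambda>n y. (- 1 / k) *s (pd (pd (q s n)) y + q s n y v* (smat \<gamma> (v s n y) + smat \<delta> (v s (n+1) y))
       + (\<gamma> * \<delta> * (qr s n n y)\<^sup>2) *s q s n y),
     r = \<lambda>n y. (1 / k) *s (pd (pd (r s n)) y + (smat \<delta> (v s n y) + smat \<gamma> (v s (n+1) y)) *v r s n y
       + (\<gamma> * \<delta> * (qr s n n y)\<^sup>2) *s r s n y),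
     logu = \<lambda>n y. (1 / k) * (
       (row_col (pd (q s n) y) (r s n y) - row_col (q s n y) (pd (r s n) y)
          + (\<gamma> - \<delta>) * (qr s n n y)\<^sup>2)
       - (row_col (pd (q s (n-1)) y) (r s (n-1) y) - row_col (q s (n-1) y) (pd (r s (n-1)) y)
          + (\<gamma> - \<delta>) * (qr s (n-1) (n-1) y)\<^sup>2)),
     v = \<lambda>n y. 0,
     w = \<lambda>n y. (1 / k) * (
       \<beta> * \<gamma> * upow s \<delta> n y *
         (- row_col (pd (q s n) y) (r s (n-1) y) + row_col (q s n y) (pd (r s (n-1)) y)
          + \<delta> * (qr s (n-1) (n-1) y + qr s n n y) * qr s n (n-1) y)
       - \<beta> * \<gamma> * upow s \<delta> (n+1) y *
         (- row_col (pd (q s (n+1)) y) (r s n y) + row_col (q s (n+1) y) (pd (r s n) y)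
          + \<delta> * (qr s n n y + qr s (n+1) (n+1) y) * qr s (n+1) n y)
       + \<alpha> * \<delta> * upow s \<gamma> n y *
         (- row_col (pd (q s (n-1)) y) (r s n y) + row_col (q s (n-1) y) (pd (r s n) y)
          - \<gamma> * (qr s (n-1) (n-1) y + qr s n n y) * qr s (n-1) n y)
       - \<alpha> * \<delta> * upow s \<gamma> (n+1) y *
         (- row_col (pd (q s n) y) (r s (n+1) y) + row_col (q s n y) (pd (r s (n+1)) y)
          - \<gamma> * (qr s n n y + qr s (n+1) (n+1) y) * qr s n (n+1) y)
       + H n) \<rparr>"

lemma t1_field:
  assumes "smooth F" "smooth_fields s"
  shows "smooth_fields (t1_field \<alpha> \<beta> \<gamma> \<delta> F s) \<and> t1_flow \<alpha> \<beta> \<gamma> \<delta> F s (t1_field \<alpha> \<beta> \<gamma> \<delta> F s)"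
proof
  show "smooth_fields (t1_field \<alpha> \<beta> \<gamma> \<delta> F s)"
    unfolding smooth_fields_def t1_field_def fields.select_convs
    by (intro allI conjI smooth_vector_intros smooth_fieldsD smooth_upow assms)
  show "t1_flow \<alpha> \<beta> \<gamma> \<delta> F s (t1_field \<alpha> \<beta> \<gamma> \<delta> F s)"
    unfolding t1_flow_def t1_field_def fields.select_convs
    by (simp add: smat_smat smat_one vec_eq_iff algebra_simps)
qed

lemma t2_field:
  assumes "k \<noteq> 0" "smooth_fields s"
  shows "smooth_fields (t2_field \<alpha> \<beta> \<gamma> \<delta> k H s) \<and> t2_flow \<alpha> \<beta> \<gamma> \<delta> k H s (t2_field \<alpha> \<beta> \<gamma> \<delta> k H s)"
proof
  show "smooth_fields (t2_field \<alpha> \<beta> \<gamma> \<delta> k H s)"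
    unfolding smooth_fields_def t2_field_def fields.select_convs
    by (intro allI conjI smooth_vector_intros smooth_fieldsD smooth_upow assms)
  have k: "k * (1 / k * x) = x" "k *s ((- 1 / k) *s y) = - y" "k *s ((1 / k) *s y) = y" for x and y :: "complex^'a"
    using assms(1) by (simp_all add: vec_eq_iff)
  show "t2_flow \<alpha> \<beta> \<gamma> \<delta> k H s (t2_field \<alpha> \<beta> \<gamma> \<delta> k H s)"
    unfolding t2_flow_def t2_field_def fields.select_convs k by simp
qed

lemma time_derivs_commute_iff:
  fixes F :: "real \<Rightarrow> complex^'m::finite^'m"
  assumes k: "k \<noteq> 0" and F: "smooth F"
  shows "time_derivs_commute \<alpha> \<beta> \<gamma> \<delta> k F H \<longleftrightarrow> (\<forall>n y. smat (\<gamma> + \<delta>) (F y) + smat (H n) (mat 1) = 0)"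
proof
  assume comm: "time_derivs_commute \<alpha> \<beta> \<gamma> \<delta> k F H"
  show "\<forall>n y. smat (\<gamma> + \<delta>) (F y) + smat (H n) (mat 1) = 0"
  proof (intro allI)
    fix n y
    have row: "H n *s axis j 1 + (\<gamma> + \<delta>) *s (axis j 1 v* F y) = 0" for j :: 'm
    proof -
      \<comment> \<open>With \<open>r = 0\<close> and the other fields constant, both sides of every
        constraint vanish.\<close>
      define s :: "'m fields" where
        "s = \<lparr> q = \<lambda>n y. axis j 1, r = \<lambda>n y. 0, logu = \<lambda>n y. 0, v = \<lambda>n y. 0, w = \<lambda>n y. 0 \<rparr>"
      have s: "smooth_fields s"
        by (simp add: smooth_fields_def s_def)
      have c: "constraints \<alpha> \<beta> \<gamma> \<delta> s"
        by (simp add: constraints_def s_def u_def[abs_def] row_col_def col_row_def smat_def vec_eq_iff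
            vector_derivative_const_at zero_vec_def[symmetric])
      let ?X1 = "t1_field \<alpha> \<beta> \<gamma> \<delta> F" and ?X2 = "t2_field \<alpha> \<beta> \<gamma> \<delta> k H"
      have "time_deriv ?X2 (time_deriv ?X1 (\<lambda>s. q s n y)) s = time_deriv ?X1 (time_deriv ?X2 (\<lambda>s. q s n y)) s"
        using comm t1_field[OF F] t2_field[OF k] s c unfolding time_derivs_commute_def by blast
      with q_commutator[OF s c t1_field[OF F] t2_field[OF k] k, where n = n and y = y and H = H]
      have "H n *s q s n y + (\<gamma> + \<delta>) *s (q s n y v* F y) = 0" by simp
      then show ?thesis by (simp add: s_def)
    qed
    show "smat (\<gamma> + \<delta>) (F y) + smat (H n) (mat 1) = 0"
      unfolding vec_eq_iff
    proof (intro allI)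
      fix j i :: 'm
      \<comment> \<open>A basis row times a matrix extracts its row \<open>j\<close>, so the vector
        equations for all \<open>j\<close> make up the matrix equation.\<close>
      have "(axis j 1 v* F y) $ i = F y $ j $ i"
        by (simp add: vector_matrix_mult_def axis_def if_distrib if_distribR cong: if_cong)
      with arg_cong[OF row[of j], of "\<lambda>x. x $ i"]
      show "(smat (\<gamma> + \<delta>) (F y) + smat (H n) (mat 1)) $ j $ i = 0 $ j $ i"
        by (auto simp: smat_def mat_def axis_def algebra_simps split: if_splits)
    qed
  qed
next
  assume cond: "\<forall>n y. smat (\<gamma> + \<delta>) (F y) + smat (H n) (mat 1) = 0"
  have ik: "\<i> * k \<noteq> 0" using k by simp
  have q0: "H n *s x + (\<gamma> + \<delta>) *s (x v* F y) = 0" and r0: "H n *s x + (\<gamma> + \<delta>) *s (F y *v x) = 0"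
    for x :: "complex^'m" and n y
  proof -
    have c: "smat (\<gamma> + \<delta>) (F y) + mat (H n) = 0"
      using cond by (simp add: smat_mat)
    show "H n *s x + (\<gamma> + \<delta>) *s (x v* F y) = 0"
      using arg_cong[OF c, of "\<lambda>A. x v* A"]
      by (simp add: vector_matrix_mult_add_rdistrib vector_matrix_smat vector_matrix_mat add.commute)
    show "H n *s x + (\<gamma> + \<delta>) *s (F y *v x) = 0"
      using arg_cong[OF c, of "\<lambda>A. A *v x"]
      by (simp add: matrix_vector_mult_add_rdistrib matrix_vector_smat matrix_vector_mat add.commute)
  qed
  show "time_derivs_commute \<alpha> \<beta> \<gamma> \<delta> k F H"
    unfolding time_derivs_commute_def
  proof (intro allI impI conjI)
    fix X1 X2 :: "'m fields \<Rightarrow> 'm fields" and s :: "'m fields" and n y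
    assume X1: "\<forall>s. smooth_fields s \<longrightarrow> smooth_fields (X1 s) \<and> t1_flow \<alpha> \<beta> \<gamma> \<delta> F s (X1 s)"
      and X2: "\<forall>s. smooth_fields s \<longrightarrow> smooth_fields (X2 s) \<and> t2_flow \<alpha> \<beta> \<gamma> \<delta> k H s (X2 s)"
      and s: "smooth_fields s" and c: "constraints \<alpha> \<beta> \<gamma> \<delta> s"
    show "time_deriv X2 (time_deriv X1 (\<lambda>s. q s n y)) s = time_deriv X1 (time_deriv X2 (\<lambda>s. q s n y)) s"
      using q_commutator[OF s c X1[rule_format] X2[rule_format] k, where n = n and y = y] ik
      unfolding q0 vector_mul_eq_0 by simp
    show "time_deriv X2 (time_deriv X1 (\<lambda>s. r s n y)) s = time_deriv X1 (time_deriv X2 (\<lambda>s. r s n y)) s"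
      using r_commutator[OF s c X1[rule_format] X2[rule_format] k, where n = n and y = y] ik
      unfolding r0 neg_0_equal_iff_equal vector_mul_eq_0 by simp
  qed
qed

section \<open>Removal of the constants of integration\<close>

lemma solution_phase_change_iff:
  fixes F :: "real \<Rightarrow> real \<Rightarrow> real \<Rightarrow> complex^'m::finite^'m" and S :: "real \<Rightarrow> real \<Rightarrow> 'm fields"
  assumes gd: "\<gamma> + \<delta> \<noteq> 0" and k: "k \<noteq> 0"
    and cond: "\<And>y t\<^sub>1 t\<^sub>2. smat (\<gamma> + \<delta>) (F y t\<^sub>1 t\<^sub>2) + smat (h t\<^sub>1 t\<^sub>2) (mat 1) = 0"
    and \<Phi>: "double_antiderivative h \<Phi>"
  defines "a \<equiv> \<lambda>t\<^sub>1 t\<^sub>2. \<i> / (\<gamma> + \<delta>) * pd (\<lambda>\<tau>. \<Phi> t\<^sub>1 \<tau>) t\<^sub>2" and "b \<equiv> \<lambda>t\<^sub>1 t\<^sub>2. 1 / k * pd (\<lambda>\<sigma>. \<Phi> \<sigma> t\<^sub>2) t\<^sub>1"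
  shows "solution \<alpha> \<beta> \<gamma> \<delta> k F (\<lambda>n. h) (phase_change k \<Phi> a b S) \<longleftrightarrow>
    solution \<alpha> \<beta> \<gamma> \<delta> k (\<lambda>_ _ _. 0) (\<lambda>_ _ _. 0) S"
proof -
  have sm: "smooth (\<lambda>(t\<^sub>1, t\<^sub>2). \<Phi> t\<^sub>1 t\<^sub>2)" and h: "pd (\<lambda>\<tau>. pd (\<lambda>\<sigma>. \<Phi> \<sigma> \<tau>) t\<^sub>1) t\<^sub>2 = h t\<^sub>1 t\<^sub>2" for t\<^sub>1 t\<^sub>2
    using \<Phi> by (simp_all add: double_antiderivative_def)
  have F: "F y t\<^sub>1 t\<^sub>2 = - mat (h t\<^sub>1 t\<^sub>2 / (\<gamma> + \<delta>))" for y t\<^sub>1 t\<^sub>2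
  proof -
    have "smat (\<gamma> + \<delta>) (F y t\<^sub>1 t\<^sub>2) = - smat (h t\<^sub>1 t\<^sub>2) (mat 1)"
      using cond[of y t\<^sub>1 t\<^sub>2] by (simp only: eq_neg_iff_add_eq_0)
    from arg_cong[OF this, of "smat (1 / (\<gamma> + \<delta>))"] show ?thesis
      using gd by (simp add: smat_smat smat_one smat_minus smat_mat)
  qed
  show ?thesis
  proof
    assume "solution \<alpha> \<beta> \<gamma> \<delta> k (\<lambda>_ _ _. 0) (\<lambda>_ _ _. 0) S"
    from solution_phase_change[OF gd k sm _ _ _ this, of h a b]
    show "solution \<alpha> \<beta> \<gamma> \<delta> k F (\<lambda>n. h) (phase_change k \<Phi> a b S)"
      by (simp add: h a_def b_def F[abs_def])
  next
    have sm': "smooth (\<lambda>(t\<^sub>1, t\<^sub>2). - \<Phi> t\<^sub>1 t\<^sub>2)"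
      using smooth_minus[OF sm] by (simp add: split_beta')
    define P where "P = (\<lambda>(t\<^sub>1, t\<^sub>2). \<Phi> t\<^sub>1 t\<^sub>2)"
    have P: "smooth P" using sm by (simp add: P_def)
    have slices: "smooth (\<lambda>\<sigma>. \<Phi> \<sigma> t\<^sub>2)" "smooth (\<lambda>\<tau>. \<Phi> t\<^sub>1 \<tau>)" for t\<^sub>1 t\<^sub>2
      using smooth_compose[OF P, of "\<lambda>\<sigma>. (\<sigma>, t\<^sub>2)"] smooth_compose[OF P, of "\<lambda>\<tau>. (t\<^sub>1, \<tau>)"]
      by (simp_all add: P_def smooth_intros)
    have n1: "pd (\<lambda>\<sigma>. - \<Phi> \<sigma> t\<^sub>2) t\<^sub>1 = - pd (\<lambda>\<sigma>. \<Phi> \<sigma> t\<^sub>2) t\<^sub>1"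
      and n2: "pd (\<lambda>\<tau>. - \<Phi> t\<^sub>1 \<tau>) t\<^sub>2 = - pd (\<lambda>\<tau>. \<Phi> t\<^sub>1 \<tau>) t\<^sub>2" for t\<^sub>1 t\<^sub>2
      by (rule pd_uminus[OF slices(1)], rule pd_uminus[OF slices(2)])
    \<comment> \<open>To negate the outer derivative, the inner one must be differentiable in
      \<open>t\<^sub>2\<close>; it is, being a partial derivative of the smooth
      \<open>P\<close>.\<close>
    have n12: "pd (\<lambda>\<tau>. - pd (\<lambda>\<sigma>. \<Phi> \<sigma> \<tau>) t\<^sub>1) t\<^sub>2 = - h t\<^sub>1 t\<^sub>2" for t\<^sub>1 t\<^sub>2
    proof -
      have "pd (\<lambda>\<sigma>. \<Phi> \<sigma> \<tau>) t\<^sub>1 = dir_deriv (1, 0) P (t\<^sub>1, \<tau>)" for \<tau>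
        using smooth_has_partials(1)[OF P] by (auto simp: P_def intro!: pd_eq)
      with smooth_has_partials(2)[OF smooth_dir_deriv[OF P, of "(1, 0)"], of t\<^sub>1 t\<^sub>2]
      have "((\<lambda>\<tau>. pd (\<lambda>\<sigma>. \<Phi> \<sigma> \<tau>) t\<^sub>1) has_vector_derivative h t\<^sub>1 t\<^sub>2) (at t\<^sub>2)"
        using h[of t\<^sub>1 t\<^sub>2] by (simp add: vector_derivative_at)
      then show ?thesis
        by (intro pd_eq has_vector_derivative_minus)
    qed
    assume "solution \<alpha> \<beta> \<gamma> \<delta> k F (\<lambda>n. h) (phase_change k \<Phi> a b S)"
    \<comment> \<open>The inverse phase change leads from the transformed fields back to
      \<open>S\<close> and adds \<open>- h\<close> to the scalar constant and
      \<open>h / (\<gamma> + \<delta>)\<close> times the identity to the matrix constant, so both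
      become 0.\<close>
    from solution_phase_change[OF gd k sm' _ _ _ this, of "\<lambda>t\<^sub>1 t\<^sub>2. - h t\<^sub>1 t\<^sub>2" "\<lambda>t\<^sub>1 t\<^sub>2. - a t\<^sub>1 t\<^sub>2" "\<lambda>t\<^sub>1 t\<^sub>2. - b t\<^sub>1 t\<^sub>2"]
    have "solution \<alpha> \<beta> \<gamma> \<delta> k (\<lambda>y t\<^sub>1 t\<^sub>2. F y t\<^sub>1 t\<^sub>2 - mat (- h t\<^sub>1 t\<^sub>2 / (\<gamma> + \<delta>))) (\<lambda>n t\<^sub>1 t\<^sub>2. h t\<^sub>1 t\<^sub>2 + - h t\<^sub>1 t\<^sub>2) S"
      unfolding phase_change_inverse by (simp add: n1 n2 n12 a_def b_def)
    moreover have "mat (- x) = - (mat x :: complex^'m^'m)" for x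
      by (simp add: mat_def vec_eq_iff)
    ultimately show "solution \<alpha> \<beta> \<gamma> \<delta> k (\<lambda>_ _ _. 0) (\<lambda>_ _ _. 0) S"
      by (simp add: F)
  qed
qed

theorem proposition3p1:
  fixes \<alpha> \<beta> \<gamma> \<delta> k :: complex
    and F :: "real \<Rightarrow> real \<Rightarrow> real \<Rightarrow> complex^'m::finite^'m"
    and H :: "int \<Rightarrow> real \<Rightarrow> real \<Rightarrow> complex"
  assumes "\<gamma> + \<delta> \<noteq> 0" and "(\<alpha> * \<gamma>, \<beta> * \<delta>) \<noteq> (0, 0)" and "k \<noteq> 0"
    and "smooth (\<lambda>(y, t\<^sub>1, t\<^sub>2). F y t\<^sub>1 t\<^sub>2)"
    and "\<And>n. smooth (\<lambda>(t\<^sub>1, t\<^sub>2). H n t\<^sub>1 t\<^sub>2)"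
  shows "(\<forall>t\<^sub>1 t\<^sub>2. time_derivs_commute \<alpha> \<beta> \<gamma> \<delta> k (\<lambda>y. F y t\<^sub>1 t\<^sub>2) (\<lambda>n. H n t\<^sub>1 t\<^sub>2) \<longleftrightarrow>
            (\<forall>n y. smat (\<gamma> + \<delta>) (F y t\<^sub>1 t\<^sub>2) + smat (H n t\<^sub>1 t\<^sub>2) (mat 1) = 0))
       \<and> ((\<forall>t\<^sub>1 t\<^sub>2. time_derivs_commute \<alpha> \<beta> \<gamma> \<delta> k (\<lambda>y. F y t\<^sub>1 t\<^sub>2) (\<lambda>n. H n t\<^sub>1 t\<^sub>2)) \<longrightarrow>
            (\<forall>y t\<^sub>1 t\<^sub>2. pd (\<lambda>z. F z t\<^sub>1 t\<^sub>2) y = 0) \<and>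
            (\<exists>H\<^sub>0. (\<forall>n t\<^sub>1 t\<^sub>2. H n t\<^sub>1 t\<^sub>2 = H\<^sub>0 t\<^sub>1 t\<^sub>2) \<and>
              (\<exists>\<Phi>. double_antiderivative H\<^sub>0 \<Phi>) \<and>
              (\<forall>\<Phi>. double_antiderivative H\<^sub>0 \<Phi> \<longrightarrow>
                (\<exists>a b. \<forall>S.
                  solution \<alpha> \<beta> \<gamma> \<delta> k F H (phase_change k \<Phi> a b S) \<longleftrightarrow>
                  solution \<alpha> \<beta> \<gamma> \<delta> k (\<lambda>_ _ _. 0) (\<lambda>_ _ _. 0) S))))"
proof -
  have F: "smooth (\<lambda>y. F y t\<^sub>1 t\<^sub>2)" for t\<^sub>1 t\<^sub>2
    using assms(4) by (rule smooth_time_slices)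
  note iff = time_derivs_commute_iff[OF \<open>k \<noteq> 0\<close> F]
  show ?thesis
  proof (intro conjI impI)
    show "\<forall>t\<^sub>1 t\<^sub>2. time_derivs_commute \<alpha> \<beta> \<gamma> \<delta> k (\<lambda>y. F y t\<^sub>1 t\<^sub>2) (\<lambda>n. H n t\<^sub>1 t\<^sub>2) \<longleftrightarrow>
        (\<forall>n y. smat (\<gamma> + \<delta>) (F y t\<^sub>1 t\<^sub>2) + smat (H n t\<^sub>1 t\<^sub>2) (mat 1) = 0)"
      by (simp add: iff)
    assume "\<forall>t\<^sub>1 t\<^sub>2. time_derivs_commute \<alpha> \<beta> \<gamma> \<delta> k (\<lambda>y. F y t\<^sub>1 t\<^sub>2) (\<lambda>n. H n t\<^sub>1 t\<^sub>2)"
    then have cond: "smat (\<gamma> + \<delta>) (F y t\<^sub>1 t\<^sub>2) + smat (H n t\<^sub>1 t\<^sub>2) (mat 1) = 0" for n y t\<^sub>1 t\<^sub>2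
      by (simp add: iff)
    \<comment> \<open>Entry by entry, the left side does not contain \<open>n\<close> and the right
      side does not contain \<open>y\<close>; this equation yields both independence
      statements.\<close>
    have FH: "(\<gamma> + \<delta>) * F y t\<^sub>1 t\<^sub>2 $ i $ j = (if i = j then - H n t\<^sub>1 t\<^sub>2 else 0)" for y n t\<^sub>1 t\<^sub>2 i j
      using arg_cong[OF cond[of y t\<^sub>1 t\<^sub>2 n], of "\<lambda>A. A $ i $ j"]
      by (auto simp: smat_def mat_def eq_neg_iff_add_eq_0)
    have "F y t\<^sub>1 t\<^sub>2 = F 0 t\<^sub>1 t\<^sub>2" for y t\<^sub>1 t\<^sub>2
    proof -
      have "(\<gamma> + \<delta>) * F y t\<^sub>1 t\<^sub>2 $ i $ j = (\<gamma> + \<delta>) * F 0 t\<^sub>1 t\<^sub>2 $ i $ j" for i j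
        unfolding FH[where n = 0] ..
      with assms(1) show ?thesis by (simp add: vec_eq_iff)
    qed
    then have "(\<lambda>z. F z t\<^sub>1 t\<^sub>2) = (\<lambda>z. F 0 t\<^sub>1 t\<^sub>2)" for t\<^sub>1 t\<^sub>2
      by (rule ext)
    then show "\<forall>y t\<^sub>1 t\<^sub>2. pd (\<lambda>z. F z t\<^sub>1 t\<^sub>2) y = 0"
      by (metis vector_derivative_const_at)
    \<comment> \<open>Site 0 is an arbitrary representative: equality with any other site follows by
      comparing a diagonal entry.\<close>
    define h where "h = H 0"
    have H: "H n = h" for n
      using FH[of 0 _ _ i i n for i] FH[of 0 _ _ i i 0 for i] by (simp add: fun_eq_iff h_def)
    show "\<exists>H\<^sub>0. (\<forall>n t\<^sub>1 t\<^sub>2. H n t\<^sub>1 t\<^sub>2 = H\<^sub>0 t\<^sub>1 t\<^sub>2) \<and>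
              (\<exists>\<Phi>. double_antiderivative H\<^sub>0 \<Phi>) \<and>
              (\<forall>\<Phi>. double_antiderivative H\<^sub>0 \<Phi> \<longrightarrow>
                (\<exists>a b. \<forall>S.
                  solution \<alpha> \<beta> \<gamma> \<delta> k F H (phase_change k \<Phi> a b S) \<longleftrightarrow>
                  solution \<alpha> \<beta> \<gamma> \<delta> k (\<lambda>_ _ _. 0) (\<lambda>_ _ _. 0) S))"
    proof (rule exI[of _ h], intro conjI allI impI)
      show "H n t\<^sub>1 t\<^sub>2 = h t\<^sub>1 t\<^sub>2" for n t\<^sub>1 t\<^sub>2
        by (simp add: H)
      show "\<exists>\<Phi>. double_antiderivative h \<Phi>"
        unfolding h_def by (rule exists_double_antiderivative[OF assms(5)])
      have H': "H = (\<lambda>n. h)"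
        by (simp add: fun_eq_iff H)
      show "\<exists>a b. \<forall>S. solution \<alpha> \<beta> \<gamma> \<delta> k F H (phase_change k \<Phi> a b S) \<longleftrightarrow>
          solution \<alpha> \<beta> \<gamma> \<delta> k (\<lambda>_ _ _. 0) (\<lambda>_ _ _. 0) S" if "double_antiderivative h \<Phi>" for \<Phi>
        using solution_phase_change_iff[where F = F, OF assms(1,3) cond[unfolded H] that] unfolding H' by blast
    qed
  qed
qed

end
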